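(* Let $G$ be a complex connected semisimple simply connected Lie group with Lie algebra $\mathfrak{g}$, Chevalley–Serre generators $\{h_i,e_i,f_i: i\in I\}$ and Cartan matrix $\|a_{ij}\|$. The adjoint action on $\mathfrak{g}$ of the Tits group $W_G^T$, via the homomorphism $W_G^T\to G$ sending $\tau_i\mapsto \dot{s}_i:=e^{f_i}e^{-e_i}e^{f_i}$, is given by $$\mathrm{Ad}_{\dot s_i}(e_i)=-f_i,\qquad \mathrm{Ad}_{\dot s_i}(f_i)=-e_i,$$ $$\mathrm{Ad}_{\dot s_i}(e_j)=e_j,\qquad \mathrm{Ad}_{\dot s_i}(f_j)=f_j,\qquad\text{if } a_{ij}=0,$$ and, for all $i\neq j$, $$\mathrm{Ad}_{\dot s_i}(e_j)=\frac{(-1)^{|a_{ij}|}}{|a_{ij}|!}\underbrace{\bigl[e_i,[\ldots[e_i}_{|a_{ij}|},e_j]\ldots]\bigr],\qquad \mathrm{Ad}_{\dot s_i}(f_j)=\frac{1}{|a_{ij}|!}\underbrace{\bigl[f_i,[\ldots[f_i}_{|a_{ij}|},f_j]\ldots]\bigr].$$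
   Context: $I$ is the set of vertices of the Dynkin diagram of $\mathfrak{g}=\mathrm{Lie}(G)$, $a_{ij}=\langle\alpha_i^\vee,\alpha_j\rangle$, and the generators satisfy: the $h_i$ commute, $[h_i,e_j]=a_{ij}e_j$, $[h_i,f_j]=-a_{ij}f_j$, $[e_i,f_j]=\delta_{ij}h_j$, and for $i\neq j$, $\mathrm{ad}_{e_i}^{1-a_{ij}}(e_j)=0$, $\mathrm{ad}_{f_i}^{1-a_{ij}}(f_j)=0$. The Tits group $W_G^T$ is generated by $\{\tau_i,\theta_i: i\in I\}$ subject to $\tau_i^2=\theta_i$, $\theta_i\theta_j=\theta_j\theta_i$, $\theta_i^2=1$, $\tau_i\theta_j=\theta_i^{-a_{ji}}\theta_j\tau_i$, and for $i\ne j$ $\underbrace{\tau_i\tau_j\tau_i\cdots}_{m_{ij}}=\underbrace{\tau_j\tau_i\tau_j\cdots}_{m_{ij}}$, where $m_{ij}=2,3,4,6$ for $a_{ij}a_{ji}=0,1,2,3$ respectively. By a theorem of Demazure and Tits, $\tau_i\mapsto\dot s_i$, $\theta_i\mapsto\dot s_i^2$ defines an embedding of $W_G^T$ into the normalizer $N_G(H)\subset G$ of the maximal torus $H$ with Lie algebra spanned by the $h_i$. The notation with underbrace $|a_{ij}|$ means the $|a_{ij}|$-fold iterated commutator, i.e. $\mathrm{ad}_{e_i}^{|a_{ij}|}(e_j)$, respectively $\mathrm{ad}_{f_i}^{|a_{ij}|}(f_j)$. *)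

theory Defs
  imports "HOL-Analysis.Analysis" "HOL-Algebra.Group_Action"
begin

section \<open>Complex Lie groups\<close>

text \<open>
  The topology of a Lie group is that of its type, which is Hausdorff and second countable by
  type class; its group structure is an HOL-Algebra group whose carrier is the whole type.
  The complex dimension is \<open>CARD('n)\<close>. A chart is its domain together with a coordinate map,
  whose values outside the domain are irrelevant.
\<close>

type_synonym ('g, 'n) chart = "'g set \<times> ('g \<Rightarrow> complex ^ 'n)"

abbreviation dom_of :: "('g, 'n) chart \<Rightarrow> 'g set"
  where "dom_of \<equiv> fst"

abbreviation coord :: "('g, 'n) chart \<Rightarrow> 'g \<Rightarrow> complex ^ 'n"
  where "coord \<equiv> snd"

definition coord_inv :: "('g, 'n) chart \<Rightarrow> complex ^ 'n \<Rightarrow> 'g"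
  where "coord_inv K = inv_into (dom_of K) (coord K)"

definition is_chart :: "('g :: topological_space, 'n :: finite) chart \<Rightarrow> bool"
  where "is_chart K \<longleftrightarrow>
    open (dom_of K) \<and> open (coord K ` dom_of K) \<and>
    homeomorphism (dom_of K) (coord K ` dom_of K) (coord K) (coord_inv K)"

text \<open>
  Complex differentiability of a map between complex vector spaces with scalar multiplications
  \<open>s\<close> and \<open>s'\<close>: the real derivative exists and is complex linear.
\<close>

definition complex_differentiable_at ::
  "(complex \<Rightarrow> 'a \<Rightarrow> 'a) \<Rightarrow> (complex \<Rightarrow> 'b \<Rightarrow> 'b) \<Rightarrow>
   ('a :: real_normed_vector \<Rightarrow> 'b :: real_normed_vector) \<Rightarrow> 'a \<Rightarrow> bool"
  where "complex_differentiable_at s s' F z \<longleftrightarrow>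
    (\<exists>F'. (F has_derivative F') (at z) \<and> Vector_Spaces.linear s s' F')"

definition scale_pair ::
  "complex \<Rightarrow> (complex ^ 'n) \<times> (complex ^ 'n) \<Rightarrow> (complex ^ 'n) \<times> (complex ^ 'n)"
  where "scale_pair c p = (c *s fst p, c *s snd p)"

definition complex_atlas :: "('g :: topological_space, 'n :: finite) chart set \<Rightarrow> bool"
  where "complex_atlas A \<longleftrightarrow>
    (\<forall>K\<in>A. is_chart K) \<and> (\<Union>K\<in>A. dom_of K) = UNIV \<and>
    (\<forall>K\<in>A. \<forall>L\<in>A. \<forall>x\<in>dom_of K \<inter> dom_of L.
       complex_differentiable_at (*s) (*s) (coord L \<circ> coord_inv K) (coord K x))"

definition complex_lie_group ::
  "'g :: {t2_space, second_countable_topology} monoid \<Rightarrow> ('g, 'n :: finite) chart set \<Rightarrow> bool"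
  where "complex_lie_group G A \<longleftrightarrow>
    group G \<and> carrier G = UNIV \<and> complex_atlas A \<and>
    continuous_on UNIV (\<lambda>(x, y). x \<otimes>\<^bsub>G\<^esub> y) \<and>
    continuous_on UNIV (\<lambda>x. inv\<^bsub>G\<^esub> x) \<and>
    (\<forall>K\<in>A. \<forall>L\<in>A. \<forall>M\<in>A. \<forall>x\<in>dom_of K. \<forall>y\<in>dom_of L. x \<otimes>\<^bsub>G\<^esub> y \<in> dom_of M \<longrightarrow>
       complex_differentiable_at scale_pair (*s)
         (\<lambda>(z, w). coord M (coord_inv K z \<otimes>\<^bsub>G\<^esub> coord_inv L w)) (coord K x, coord L y)) \<and>
    (\<forall>K\<in>A. \<forall>L\<in>A. \<forall>x\<in>dom_of K. inv\<^bsub>G\<^esub> x \<in> dom_of L \<longrightarrow>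
       complex_differentiable_at (*s) (*s)
         (\<lambda>z. coord L (inv\<^bsub>G\<^esub> (coord_inv K z))) (coord K x))"


subsection \<open>Lie algebra, adjoint representation, exponential map\<close>

text \<open>
  The tangent space at the identity is written in the coordinates of a chart \<open>K\<close> around the
  identity, so that the Lie algebra is \<open>complex ^ 'n\<close> with the bracket below; another chart
  gives an isomorphic Lie algebra. \<open>Ad g\<close> is the derivative at the identity of conjugation
  by \<open>g\<close>, and the bracket is the derivative of \<open>Ad\<close> at the identity:
  \<open>[X, Y] = (d Ad)(X) Y\<close>. For matrix groups this is \<open>XY - YX\<close>.
\<close>

definition Ad :: "'g monoid \<Rightarrow> ('g, 'n :: finite) chart \<Rightarrow> 'g \<Rightarrow> complex ^ 'n \<Rightarrow> complex ^ 'n"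
  where "Ad G K g =
    frechet_derivative (\<lambda>z. coord K (g \<otimes>\<^bsub>G\<^esub> coord_inv K z \<otimes>\<^bsub>G\<^esub> inv\<^bsub>G\<^esub> g)) (at (coord K \<one>\<^bsub>G\<^esub>))"

definition lie_bracket ::
  "'g monoid \<Rightarrow> ('g, 'n :: finite) chart \<Rightarrow> complex ^ 'n \<Rightarrow> complex ^ 'n \<Rightarrow> complex ^ 'n"
  where "lie_bracket G K X Y =
    frechet_derivative (\<lambda>z. Ad G K (coord_inv K z) Y) (at (coord K \<one>\<^bsub>G\<^esub>)) X"

definition one_parameter_subgroup ::
  "'g :: topological_space monoid \<Rightarrow> ('g, 'n :: finite) chart \<Rightarrow> complex ^ 'n \<Rightarrow> (real \<Rightarrow> 'g) \<Rightarrow> bool"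
  where "one_parameter_subgroup G K X \<gamma> \<longleftrightarrow>
    continuous_on UNIV \<gamma> \<and> (\<forall>s t. \<gamma> (s + t) = \<gamma> s \<otimes>\<^bsub>G\<^esub> \<gamma> t) \<and>
    ((\<lambda>t. coord K (\<gamma> t)) has_vector_derivative X) (at 0)"

text \<open>
  There is exactly one one-parameter subgroup with a given velocity, hence exactly one
  exponential map.
\<close>

definition exponential_map ::
  "'g :: topological_space monoid \<Rightarrow> ('g, 'n :: finite) chart \<Rightarrow> (complex ^ 'n \<Rightarrow> 'g) \<Rightarrow> bool"
  where "exponential_map G K Exp \<longleftrightarrow>
    (\<forall>X. one_parameter_subgroup G K X (\<lambda>t. Exp (t *\<^sub>R X)))"


section \<open>Semisimple Lie algebras and Chevalley--Serre generators\<close>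

type_synonym 'n bracket = "complex ^ 'n \<Rightarrow> complex ^ 'n \<Rightarrow> complex ^ 'n"

definition lie_subalgebra :: "'n :: finite bracket \<Rightarrow> (complex ^ 'n) set \<Rightarrow> bool"
  where "lie_subalgebra br S \<longleftrightarrow> vec.subspace S \<and> (\<forall>x\<in>S. \<forall>y\<in>S. br x y \<in> S)"

definition lie_ideal :: "'n :: finite bracket \<Rightarrow> (complex ^ 'n) set \<Rightarrow> bool"
  where "lie_ideal br S \<longleftrightarrow> vec.subspace S \<and> (\<forall>x. \<forall>y\<in>S. br x y \<in> S)"

definition derived_algebra :: "'n :: finite bracket \<Rightarrow> (complex ^ 'n) set \<Rightarrow> (complex ^ 'n) set"
  where "derived_algebra br S = vec.span {br x y | x y. x \<in> S \<and> y \<in> S}"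

definition lie_solvable :: "'n :: finite bracket \<Rightarrow> (complex ^ 'n) set \<Rightarrow> bool"
  where "lie_solvable br S \<longleftrightarrow> (\<exists>k. (derived_algebra br ^^ k) S = {0})"

definition semisimple :: "'n :: finite bracket \<Rightarrow> bool"
  where "semisimple br \<longleftrightarrow> (\<forall>S. lie_ideal br S \<and> lie_solvable br S \<longrightarrow> S = {0})"

definition lie_generates :: "'n :: finite bracket \<Rightarrow> (complex ^ 'n) set \<Rightarrow> bool"
  where "lie_generates br X \<longleftrightarrow> (\<forall>S. lie_subalgebra br S \<and> X \<subseteq> S \<longrightarrow> S = UNIV)"

definition toral_subalgebra :: "'n :: finite bracket \<Rightarrow> (complex ^ 'n) set \<Rightarrow> bool"
  where "toral_subalgebra br H \<longleftrightarrow>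
    lie_subalgebra br H \<and> (\<forall>t\<in>H. vec.span {x. \<exists>c. br t x = c *s x} = UNIV)"

text \<open>In a semisimple Lie algebra, Cartan subalgebras are the maximal toral subalgebras.\<close>

definition cartan_subalgebra :: "'n :: finite bracket \<Rightarrow> (complex ^ 'n) set \<Rightarrow> bool"
  where "cartan_subalgebra br H \<longleftrightarrow>
    toral_subalgebra br H \<and> (\<forall>T. toral_subalgebra br T \<and> H \<subseteq> T \<longrightarrow> T = H)"

text \<open>
  Functionals on the Cartan subalgebra \<open>H\<close> are represented by functions on the whole Lie
  algebra, of which only the restriction to \<open>H\<close> matters. Linearity on \<open>H\<close> of a root is
  automatic, because its root space is nonzero.
\<close>

definition root_space ::
  "'n :: finite bracket \<Rightarrow> (complex ^ 'n) set \<Rightarrow> (complex ^ 'n \<Rightarrow> complex) \<Rightarrow> (complex ^ 'n) set"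
  where "root_space br H \<beta> = {x. \<forall>t\<in>H. br t x = \<beta> t *s x}"

definition is_root ::
  "'n :: finite bracket \<Rightarrow> (complex ^ 'n) set \<Rightarrow> (complex ^ 'n \<Rightarrow> complex) \<Rightarrow> bool"
  where "is_root br H \<beta> \<longleftrightarrow> (\<exists>t\<in>H. \<beta> t \<noteq> 0) \<and> (\<exists>x\<in>root_space br H \<beta>. x \<noteq> 0)"

definition simple_roots ::
  "'n :: finite bracket \<Rightarrow> (complex ^ 'n) set \<Rightarrow> 'i set \<Rightarrow> ('i \<Rightarrow> complex ^ 'n \<Rightarrow> complex) \<Rightarrow> bool"
  where "simple_roots br H I \<alpha> \<longleftrightarrow>
    finite I \<and> (\<forall>j\<in>I. is_root br H (\<alpha> j)) \<and>
    (\<forall>c :: 'i \<Rightarrow> complex. (\<forall>t\<in>H. (\<Sum>j\<in>I. c j * \<alpha> j t) = 0) \<longrightarrow> (\<forall>j\<in>I. c j = 0)) \<and>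
    (\<forall>\<beta>. is_root br H \<beta> \<longrightarrow>
       (\<exists>n :: 'i \<Rightarrow> nat. (\<forall>t\<in>H. \<beta> t = (\<Sum>j\<in>I. of_nat (n j) * \<alpha> j t)) \<or>
                        (\<forall>t\<in>H. \<beta> t = - (\<Sum>j\<in>I. of_nat (n j) * \<alpha> j t))))"

text \<open>
  The coroot of \<open>\<beta>\<close> is the element of \<open>[\<gg>\<^sub>\<beta>, \<gg>\<^sub>-\<^sub>\<beta>]\<close> on which \<open>\<beta>\<close> takes the value 2.
\<close>

definition is_coroot ::
  "'n :: finite bracket \<Rightarrow> (complex ^ 'n) set \<Rightarrow> (complex ^ 'n \<Rightarrow> complex) \<Rightarrow> complex ^ 'n \<Rightarrow> bool"
  where "is_coroot br H \<beta> t \<longleftrightarrow>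
    t \<in> vec.span {br x y | x y. x \<in> root_space br H \<beta> \<and> y \<in> root_space br H (\<lambda>t. - \<beta> t)} \<and>
    \<beta> t = 2"

text \<open>
  Chevalley--Serre generators \<open>h\<close>, \<open>e\<close>, \<open>f\<close> for the Cartan subalgebra spanned by the
  \<open>h i\<close>, the simple roots \<open>\<alpha>\<close> and the Cartan matrix
  \<open>a i j = \<langle>\<alpha>\<^sub>i\<^sup>\<or>, \<alpha>\<^sub>j\<rangle> = \<alpha>\<^sub>j(h\<^sub>i)\<close>.
\<close>

definition chevalley_serre_generators ::
  "'n :: finite bracket \<Rightarrow> 'i set \<Rightarrow> ('i \<Rightarrow> complex ^ 'n \<Rightarrow> complex) \<Rightarrow> ('i \<Rightarrow> 'i \<Rightarrow> int) \<Rightarrow>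
   ('i \<Rightarrow> complex ^ 'n) \<Rightarrow> ('i \<Rightarrow> complex ^ 'n) \<Rightarrow> ('i \<Rightarrow> complex ^ 'n) \<Rightarrow> bool"
  where "chevalley_serre_generators br I \<alpha> a h e f \<longleftrightarrow>
    (let H = vec.span (h ` I) in
      cartan_subalgebra br H \<and> simple_roots br H I \<alpha> \<and>
      (\<forall>i\<in>I. is_coroot br H (\<alpha> i) (h i)) \<and>
      (\<forall>i\<in>I. \<forall>j\<in>I. \<alpha> j (h i) = of_int (a i j)) \<and>
      (\<forall>i\<in>I. e i \<in> root_space br H (\<alpha> i) \<and> f i \<in> root_space br H (\<lambda>t. - \<alpha> i t))) \<and>
    (\<forall>i\<in>I. \<forall>j\<in>I. br (h i) (h j) = 0) \<and>
    (\<forall>i\<in>I. \<forall>j\<in>I. br (h i) (e j) = of_int (a i j) *s e j) \<and>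
    (\<forall>i\<in>I. \<forall>j\<in>I. br (h i) (f j) = - (of_int (a i j) *s f j)) \<and>
    (\<forall>i\<in>I. \<forall>j\<in>I. br (e i) (f j) = (if i = j then h j else 0)) \<and>
    (\<forall>i\<in>I. \<forall>j\<in>I. i \<noteq> j \<longrightarrow> (br (e i) ^^ nat (1 - a i j)) (e j) = 0) \<and>
    (\<forall>i\<in>I. \<forall>j\<in>I. i \<noteq> j \<longrightarrow> (br (f i) ^^ nat (1 - a i j)) (f j) = 0) \<and>
    lie_generates br (h ` I \<union> e ` I \<union> f ` I)"


section \<open>The Tits group\<close>

text \<open>
  Groups given by generators \<open>X\<close> and relations \<open>R\<close>. In a word, the letter \<open>(x, True)\<close> is the
  generator \<open>x\<close> and \<open>(x, False)\<close> is its inverse; a pair \<open>(l, r)\<close> in \<open>R\<close> is the relation \<open>l = r\<close>.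
\<close>

type_synonym 'x word = "('x \<times> bool) list"

inductive word_eq :: "('x word \<times> 'x word) set \<Rightarrow> 'x word \<Rightarrow> 'x word \<Rightarrow> bool"
  for R :: "('x word \<times> 'x word) set" where
  refl: "word_eq R w w"
| sym: "word_eq R v w \<Longrightarrow> word_eq R w v"
| trans: "word_eq R u v \<Longrightarrow> word_eq R v w \<Longrightarrow> word_eq R u w"
| cancel: "word_eq R (u @ [(x, b), (x, \<not> b)] @ v) (u @ v)"
| relator: "(l, r) \<in> R \<Longrightarrow> word_eq R (u @ l @ v) (u @ r @ v)"

definition word_class :: "'x set \<Rightarrow> ('x word \<times> 'x word) set \<Rightarrow> 'x word \<Rightarrow> 'x word set"
  where "word_class X R w = {v \<in> lists (X \<times> UNIV). word_eq R w v}"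

definition presented_group :: "'x set \<Rightarrow> ('x word \<times> 'x word) set \<Rightarrow> 'x word set monoid"
  where "presented_group X R =
    \<lparr>carrier = word_class X R ` lists (X \<times> UNIV),
     mult = (\<lambda>U V. \<Union>u\<in>U. \<Union>v\<in>V. word_class X R (u @ v)),
     one = word_class X R []\<rparr>"

lemma word_eq_append:
  assumes "word_eq R u u'" and "word_eq R v v'"
  shows "word_eq R (u @ v) (u' @ v')"
proof -
  have 1: "word_eq R (u @ w) (u' @ w)" for w
    using assms(1)
  proof (induction rule: word_eq.induct)
    case (cancel u x b v)
    then show ?case using word_eq.cancel[of R u x b "v @ w"] by simp
  next
    case (relator l r u v)
    then show ?case using word_eq.relator[of l r R u "v @ w"] by simp
  next
    case (trans u v w)
    from trans.IH show ?case by (rule word_eq.trans)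
  next
    case (sym v w)
    from sym.IH show ?case by (rule word_eq.sym)
  qed (rule word_eq.refl)
  have 2: "word_eq R (w @ v) (w @ v')" for w
    using assms(2)
  proof (induction rule: word_eq.induct)
    case (cancel u x b v)
    then show ?case using word_eq.cancel[of R "w @ u" x b v] by simp
  next
    case (relator l r u v)
    then show ?case using word_eq.relator[of l r R "w @ u" v] by simp
  next
    case (trans u v w)
    from trans.IH show ?case by (rule word_eq.trans)
  next
    case (sym v w)
    from sym.IH show ?case by (rule word_eq.sym)
  qed (rule word_eq.refl)
  show ?thesis by (rule word_eq.trans[OF 1 2])
qed

lemma word_class_eqI:
  assumes "word_eq R v w"
  shows "word_class X R v = word_class X R w"
proof -
  have "word_eq R v u \<longleftrightarrow> word_eq R w u" for u
    using word_eq.trans[OF assms] word_eq.trans[OF word_eq.sym[OF assms]] by metis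
  then show ?thesis by (simp add: word_class_def)
qed

lemma mult_word_class:
  assumes "u \<in> lists (X \<times> UNIV)" "v \<in> lists (X \<times> UNIV)"
  shows "word_class X R u \<otimes>\<^bsub>presented_group X R\<^esub> word_class X R v = word_class X R (u @ v)"
proof -
  have eq: "word_class X R (u' @ v') = word_class X R (u @ v)"
    if "u' \<in> word_class X R u" "v' \<in> word_class X R v" for u' v'
  proof -
    have "word_eq R u u'" "word_eq R v v'"
      using that by (simp_all add: word_class_def)
    then show ?thesis by (rule word_class_eqI[OF word_eq_append, symmetric])
  qed
  have "(\<Union>u'\<in>word_class X R u. \<Union>v'\<in>word_class X R v. word_class X R (u' @ v')) =
      (\<Union>u'\<in>word_class X R u. \<Union>v'\<in>word_class X R v. word_class X R (u @ v))"
    by (intro SUP_cong HOL.refl eq)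
  moreover have "u \<in> word_class X R u" "v \<in> word_class X R v"
    using assms unfolding word_class_def by (auto intro: word_eq.refl)
  ultimately show ?thesis
    unfolding presented_group_def monoid.simps by blast
qed

lemma word_eq_inverse: "word_eq R (rev (map (\<lambda>(x, b). (x, \<not> b)) w) @ w) []"
proof (induction w)
  case (Cons p w)
  obtain x b where p: "p = (x, b)" by force
  show ?case
    using word_eq.trans[OF
        word_eq.cancel[of R "rev (map (\<lambda>(x, b). (x, \<not> b)) w)" x "\<not> b" w] Cons.IH] p
    by simp
qed (simp add: word_eq.refl)

lemma group_presented_group: "group (presented_group X R)"
proof (rule groupI)
  let ?P = "presented_group X R"
  have carr: "carrier ?P = word_class X R ` lists (X \<times> UNIV)"
    and one: "\<one>\<^bsub>?P\<^esub> = word_class X R []"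
    by (simp_all add: presented_group_def)
  show "\<one>\<^bsub>?P\<^esub> \<in> carrier ?P" by (auto simp: carr one)
  fix x assume "x \<in> carrier ?P"
  then obtain u where u: "u \<in> lists (X \<times> UNIV)" "x = word_class X R u" by (auto simp: carr)
  show "\<one>\<^bsub>?P\<^esub> \<otimes>\<^bsub>?P\<^esub> x = x"
    using u mult_word_class[of "[]" X u R] by (simp add: one)
  let ?v = "rev (map (\<lambda>(x, b). (x, \<not> b)) u)"
  have v: "?v \<in> lists (X \<times> UNIV)" using u(1) by (auto simp: in_lists_conv_set)
  show "\<exists>y\<in>carrier ?P. y \<otimes>\<^bsub>?P\<^esub> x = \<one>\<^bsub>?P\<^esub>"
  proof
    show "word_class X R ?v \<in> carrier ?P" using v unfolding carr by (rule imageI)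
    show "word_class X R ?v \<otimes>\<^bsub>?P\<^esub> x = \<one>\<^bsub>?P\<^esub>"
      unfolding u(2) one mult_word_class[OF v u(1)] by (rule word_class_eqI[OF word_eq_inverse])
  qed
  fix y assume "y \<in> carrier ?P"
  then obtain v where v: "v \<in> lists (X \<times> UNIV)" "y = word_class X R v" by (auto simp: carr)
  show "x \<otimes>\<^bsub>?P\<^esub> y \<in> carrier ?P"
    unfolding u(2) v(2) mult_word_class[OF u(1) v(1)] carr
    by (rule imageI) (use u(1) v(1) in auto)
  fix z assume "z \<in> carrier ?P"
  then obtain w where w: "w \<in> lists (X \<times> UNIV)" "z = word_class X R w" by (auto simp: carr)
  show "x \<otimes>\<^bsub>?P\<^esub> y \<otimes>\<^bsub>?P\<^esub> z = x \<otimes>\<^bsub>?P\<^esub> (y \<otimes>\<^bsub>?P\<^esub> z)"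
  proof -
    have uv: "u @ v \<in> lists (X \<times> UNIV)" and vw: "v @ w \<in> lists (X \<times> UNIV)"
      using u(1) v(1) w(1) by auto
    show ?thesis
      unfolding u(2) v(2) w(2) mult_word_class[OF u(1) v(1)] mult_word_class[OF v(1) w(1)]
        mult_word_class[OF uv w(1)] mult_word_class[OF u(1) vw] by simp
  qed
qed

datatype 'i tits_generator = Tau 'i | Theta 'i

definition letter_power :: "'x \<Rightarrow> int \<Rightarrow> 'x word"
  where "letter_power x k = replicate (nat \<bar>k\<bar>) (x, k \<ge> 0)"

definition alternating_word :: "nat \<Rightarrow> 'x \<Rightarrow> 'x \<Rightarrow> 'x word"
  where "alternating_word m x y = map (\<lambda>k. (if even k then x else y, True)) [0..<m]"

text \<open>For a Cartan matrix the argument \<open>a i j * a j i\<close>, with \<open>i \<noteq> j\<close>, is 0, 1, 2 or 3.\<close>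

definition braid_length :: "int \<Rightarrow> nat"
  where "braid_length p = (if p = 0 then 2 else if p = 1 then 3 else if p = 2 then 4 else 6)"

definition tits_relations ::
  "'i set \<Rightarrow> ('i \<Rightarrow> 'i \<Rightarrow> int) \<Rightarrow> ('i tits_generator word \<times> 'i tits_generator word) set"
  where "tits_relations I a =
    {([(Tau i, True), (Tau i, True)], [(Theta i, True)]) | i. i \<in> I} \<union>
    {([(Theta i, True), (Theta j, True)], [(Theta j, True), (Theta i, True)]) | i j.
       i \<in> I \<and> j \<in> I} \<union>
    {([(Theta i, True), (Theta i, True)], []) | i. i \<in> I} \<union>
    {([(Tau i, True), (Theta j, True)],
      letter_power (Theta i) (- a j i) @ [(Theta j, True), (Tau i, True)]) | i j.
       i \<in> I \<and> j \<in> I} \<union>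
    {(alternating_word (braid_length (a i j * a j i)) (Tau i) (Tau j),
      alternating_word (braid_length (a i j * a j i)) (Tau j) (Tau i)) | i j.
       i \<in> I \<and> j \<in> I \<and> i \<noteq> j}"

definition tits_group :: "'i set \<Rightarrow> ('i \<Rightarrow> 'i \<Rightarrow> int) \<Rightarrow> 'i tits_generator word set monoid"
  where "tits_group I a = presented_group (Tau ` I \<union> Theta ` I) (tits_relations I a)"

definition tits_gen ::
  "'i set \<Rightarrow> ('i \<Rightarrow> 'i \<Rightarrow> int) \<Rightarrow> 'i tits_generator \<Rightarrow> 'i tits_generator word set"
  where "tits_gen I a x = word_class (Tau ` I \<union> Theta ` I) (tits_relations I a) [(x, True)]"

definition s_dot ::
  "'g monoid \<Rightarrow> (complex ^ 'n \<Rightarrow> 'g) \<Rightarrow> ('i \<Rightarrow> complex ^ 'n) \<Rightarrow> ('i \<Rightarrow> complex ^ 'n) \<Rightarrow> 'i \<Rightarrow> 'g"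
  where "s_dot G Exp e f i = Exp (f i) \<otimes>\<^bsub>G\<^esub> Exp (- e i) \<otimes>\<^bsub>G\<^esub> Exp (f i)"

end

theory Submission
  imports Defs "HOL-Complex_Analysis.Cauchy_Integral_Formula"
begin

text \<open>
  The group operations are only assumed to be complex differentiable, so the second derivative
  behind the Lie bracket has to be produced first (without it, the bracket is a junk value of
  \<open>frechet_derivative\<close>): this is Cauchy's inequality applied to conjugation in a chart.
  Then \<open>Ad g\<close> preserves the bracket, \<open>Ad (exp t X)\<close> fixes \<open>X\<close>, and differentiating these two
  facts gives the Jacobi identity and antisymmetry. If \<open>ad X\<close> is nilpotent on \<open>Y\<close>, then
  \<open>Ad (exp X) Y\<close> is the finite exponential series of \<open>ad X\<close>, because both are solutions of the same
  differential equation. What remains is a computation in the \<open>sl\<^sub>2\<close>-strings through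
  \<open>e\<^sub>j\<close> and \<open>f\<^sub>j\<close>, which start at a vector killed by \<open>f\<^sub>i\<close> and \<open>e\<^sub>i\<close> respectively.
\<close>

section \<open>Differentiating a derivative in a parameter\<close>

lemma norm_vector_scale_complex: "norm (c *s x) = norm c * norm (x :: complex ^ 'n)"
  by (simp add: norm_vec_def norm_mult L2_set_right_distrib)

lemma scaleR_eq_vector_scale: "r *\<^sub>R (x :: complex ^ 'n) = of_real r *s x"
  by (simp add: vec_eq_iff scaleR_conv_of_real[where 'a = complex])

text \<open>Taylor's formula of order one, with the second derivative bounded on the half-size disc
  by Cauchy's inequality. Circles of radius \<open>R / 4\<close> about its points stay inside
  \<open>ball 0 R\<close>, whence the constant \<open>2! * M / (R / 4)^2\<close>.\<close>

lemma holomorphic_first_order_bound: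
  fixes f :: "complex \<Rightarrow> complex"
  assumes hol: "f holomorphic_on ball 0 R" and R: "0 < R"
    and bound: "\<And>z. z \<in> ball 0 R \<Longrightarrow> norm (f z) \<le> M" and s: "norm s < R / 2"
  shows "norm (f s - f 0 - deriv f 0 * s) \<le> 32 * M / R\<^sup>2 * norm s ^ 2"
proof -
  define F where "F = (\<lambda>n::nat. (deriv ^^ n) f)"
  have der: "(F i has_field_derivative F (Suc i) x) (at x within ball 0 (R / 2))"
    if "x \<in> ball 0 (R / 2)" for i x
  proof -
    have "F i holomorphic_on ball 0 R" unfolding F_def
      by (rule holomorphic_higher_deriv[OF hol]) simp
    then have "(F i has_field_derivative deriv (F i) x) (at x)"
      using holomorphic_derivI[of "F i" "ball 0 R" x] that R by auto
    then show ?thesis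
      by (simp add: F_def has_field_derivative_at_within)
  qed
  have B: "norm (F (Suc 1) x) \<le> 32 * M / R\<^sup>2" if x: "x \<in> ball 0 (R / 2)" for x
  proof -
    have sub: "cball x (R / 4) \<subseteq> ball 0 R"
    proof
      fix y assume "y \<in> cball x (R / 4)"
      then show "y \<in> ball 0 R"
        using x R norm_triangle_ineq4[of x "x - y"] by (simp add: dist_norm)
    qed
    have "norm ((deriv ^^ 2) f x) \<le> fact 2 * M / (R / 4) ^ 2"
    proof (rule Cauchy_inequality)
      show "f holomorphic_on ball x (R / 4)"
        using sub ball_subset_cball by (intro holomorphic_on_subset[OF hol]) blast
      show "continuous_on (cball x (R / 4)) f"
        using hol sub continuous_on_subset holomorphic_on_imp_continuous_on by blast
      show "norm (f y) \<le> M" if "norm (x - y) = R / 4" for y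
        using that sub by (intro bound) (auto simp: dist_norm)
    qed (use R in simp)
    then show ?thesis by (simp add: F_def numeral_2_eq_2 power2_eq_square field_simps)
  qed
  have "norm (F 0 s - (\<Sum>i\<le>1. F i 0 * (s - 0) ^ i / fact i)) \<le> 32 * M / R\<^sup>2 * norm (s - 0) ^ Suc 1 / fact 1"
    by (rule field_Taylor[of "ball 0 (R / 2)" 1 F]) (use der B s R in auto)
  then show ?thesis by (simp add: F_def algebra_simps power2_eq_square)
qed

text \<open>The remainder \<open>E v \<zeta>\<close> of the first-order expansion in \<open>z\<close> is holomorphic in \<open>\<zeta>\<close> and
  \<open>O(\<bar>v\<bar>\<^sup>2)\<close> uniformly in \<open>\<zeta>\<close>, so by Cauchy's inequality its \<open>\<zeta>\<close>-derivative at 0 is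
  \<open>O(\<bar>v\<bar>\<^sup>2)\<close> as well.\<close>

lemma differentiable_parametric_deriv:
  fixes \<psi> :: "complex ^ 'n \<Rightarrow> complex \<Rightarrow> complex"
  assumes r: "0 < r"
    and bound: "\<And>z \<zeta>. z \<in> ball k r \<Longrightarrow> \<zeta> \<in> ball 0 r \<Longrightarrow> norm (\<psi> z \<zeta>) \<le> M"
    and hol1: "\<And>\<zeta> z v. \<zeta> \<in> ball 0 r \<Longrightarrow> z \<in> ball k r \<Longrightarrow>
      (\<lambda>s. \<psi> (z + s *s v) \<zeta>) field_differentiable (at 0)"
    and hol2: "\<And>z. z \<in> ball k r \<Longrightarrow> \<psi> z holomorphic_on ball 0 r"
    and D: "\<And>\<zeta>. \<zeta> \<in> ball 0 r \<Longrightarrow> ((\<lambda>z. \<psi> z \<zeta>) has_derivative D \<zeta>) (at k)"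
  shows "(\<lambda>z. deriv (\<psi> z) 0) differentiable (at k)"
proof -
  have lin: "linear (D \<zeta>)" if "\<zeta> \<in> ball 0 r" for \<zeta>
    using D[OF that] by (rule has_derivative_linear)
  have "0 \<le> M"
    using order_trans[OF norm_ge_zero bound[of k 0]] r by simp
  define C where "C = 32 * M / r\<^sup>2"
  have C: "0 \<le> C" using \<open>0 \<le> M\<close> by (simp add: C_def)
  define E where "E = (\<lambda>v \<zeta>. \<psi> (k + v) \<zeta> - \<psi> k \<zeta> - D \<zeta> v)"
  have E: "norm (E v \<zeta>) \<le> C * norm v ^ 2" if v: "norm v < r / 2" and \<zeta>: "\<zeta> \<in> ball 0 r" for v \<zeta>
  proof (cases "v = 0")
    case True
    then show ?thesis using linear_0[OF lin[OF \<zeta>]] by (simp add: E_def)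
  next
    case False
    \<comment> \<open>Restrict to the complex line through \<open>k\<close> in direction
      \<open>v\<close>. It stays in \<open>ball k r\<close> for \<open>norm s < R\<close>, the value
      wanted is at \<open>s = 1\<close>, and \<open>1 / R\<^sup>2\<close> produces the factor
      \<open>norm v ^ 2\<close>.\<close>
    define R where "R = r / norm v"
    define g where "g = (\<lambda>s. \<psi> (k + s *s v) \<zeta>)"
    have R: "0 < R" "norm (1::complex) < R / 2"
      using r False v by (auto simp: R_def field_simps)
    have inb: "k + s *s v \<in> ball k r" if "s \<in> ball 0 R" for s
      using that False by (simp add: dist_norm norm_vector_scale_complex R_def field_simps)
    have "g field_differentiable (at s)" if s: "s \<in> ball 0 R" for s
    proof -
      obtain c where "((\<lambda>u. \<psi> (k + s *s v + u *s v) \<zeta>) has_field_derivative c) (at 0)"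
        using hol1[OF \<zeta> inb[OF s], of v] by (auto simp: field_differentiable_def)
      then have "((\<lambda>u. g (u + s)) has_field_derivative c) (at 0)"
        by (simp add: g_def vector_sadd_rdistrib algebra_simps)
      then show ?thesis
        using DERIV_shift[of g c 0 s] by (auto simp: field_differentiable_def)
    qed
    then have hol: "g holomorphic_on ball 0 R"
      by (auto simp: holomorphic_on_def intro: field_differentiable_at_within)
    have "norm (g 1 - g 0 - deriv g 0 * 1) \<le> 32 * M / R\<^sup>2 * norm (1::complex) ^ 2"
      by (rule holomorphic_first_order_bound[OF hol R(1) _ R(2)])
        (use inb \<zeta> in \<open>auto simp: g_def intro!: bound\<close>)
    \<comment> \<open>\<open>D \<zeta>\<close> is given only as a real derivative, so it is compared
      with the complex derivative of \<open>g\<close> along real parameters.\<close>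
    moreover have "deriv g 0 = D \<zeta> v"
    proof -
      have "(g has_field_derivative deriv g 0) (at 0)"
        using holomorphic_derivI[OF hol, of 0] R by simp
      then have "((\<lambda>t. g (of_real t)) has_vector_derivative deriv g 0) (at (0::real))"
        using field_vector_diff_chain_at[of of_real 1 0 g "deriv g 0"]
        by (simp add: o_def has_vector_derivative_of_real[OF DERIV_ident, simplified])
      moreover have "((\<lambda>t. g (of_real t)) has_vector_derivative D \<zeta> v) (at (0::real))"
      proof -
        have "((\<lambda>t. k + t *\<^sub>R v) has_derivative (\<lambda>t. t *\<^sub>R v)) (at 0)"
          by (auto intro!: derivative_eq_intros)
        from has_derivative_compose[OF this, of "\<lambda>z. \<psi> z \<zeta>" "D \<zeta>"] D[OF \<zeta>]
        show ?thesis
          by (simp add: has_vector_derivative_def g_def scaleR_eq_vector_scale[symmetric]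
              linear_cmul[OF lin[OF \<zeta>]])
      qed
      ultimately show ?thesis using vector_derivative_unique_at by blast
    qed
    ultimately show ?thesis
      using False by (simp add: E_def g_def C_def R_def field_simps)
  qed
  have holD: "(\<lambda>\<zeta>. D \<zeta> v) holomorphic_on ball 0 r" for v
  proof -
    \<comment> \<open>\<open>D \<zeta> v\<close> will be a uniform limit of difference quotients
      with steps \<open>1 / N n\<close>, the bound on \<open>E\<close> giving the error
      \<open>C * norm v ^ 2 / N n\<close>. The choice of \<open>q\<close> keeps
      \<open>v /\<^sub>R N n\<close> within radius \<open>r / 2\<close> already for
      \<open>n = 0\<close>, also when \<open>v = 0\<close>.\<close>
    define q where "q = 2 * (norm v + 1) / r"
    have q: "0 < q" using r by (simp add: q_def add_nonneg_pos)
    define N where "N = (\<lambda>n::nat. q * real (Suc n))"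
    have Nq: "q \<le> N n" "0 < N n" for n using q by (auto simp: N_def mult_pos_pos)
    have small: "norm (v /\<^sub>R N n) < r / 2" for n
    proof -
      have "norm v * 2 < r * q" using r by (simp add: q_def)
      also have "\<dots> \<le> r * N n" using Nq r by simp
      finally show ?thesis using Nq[of n] by (simp add: field_simps)
    qed
    show ?thesis
    proof (rule holomorphic_uniform_sequence)
      show "(\<lambda>\<zeta>. of_real (N n) * (\<psi> (k + v /\<^sub>R N n) \<zeta> - \<psi> k \<zeta>)) holomorphic_on ball 0 r" for n
      proof -
        have "k + v /\<^sub>R N n \<in> ball k r" using small[of n] r by (simp add: dist_norm)
        then show ?thesis using hol2 r by (intro holomorphic_intros) auto
      qed
      have "uniform_limit (ball 0 r) (\<lambda>n \<zeta>. of_real (N n) * (\<psi> (k + v /\<^sub>R N n) \<zeta> - \<psi> k \<zeta>)) (\<lambda>\<zeta>. D \<zeta> v) sequentially"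
      proof (rule uniform_limitI)
        fix \<epsilon> :: real assume "0 < \<epsilon>"
        have "(\<lambda>n. C * norm v ^ 2 / q * inverse (real (Suc n))) \<longlonglongrightarrow> C * norm v ^ 2 / q * 0"
          by (intro tendsto_intros LIMSEQ_inverse_real_of_nat)
        then have "\<forall>\<^sub>F n in sequentially. C * norm v ^ 2 / q * inverse (real (Suc n)) < \<epsilon>"
          using \<open>0 < \<epsilon>\<close> by (simp add: order_tendsto_iff)
        then show "\<forall>\<^sub>F n in sequentially. \<forall>\<zeta>\<in>ball 0 r.
            dist (of_real (N n) * (\<psi> (k + v /\<^sub>R N n) \<zeta> - \<psi> k \<zeta>)) (D \<zeta> v) < \<epsilon>"
        proof (rule eventually_mono, intro ballI)
          fix n and \<zeta> :: complex assume n: "C * norm v ^ 2 / q * inverse (real (Suc n)) < \<epsilon>"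
            and \<zeta>: "\<zeta> \<in> ball 0 r"
          have "of_real (N n) * (\<psi> (k + v /\<^sub>R N n) \<zeta> - \<psi> k \<zeta>) - D \<zeta> v = of_real (N n) * E (v /\<^sub>R N n) \<zeta>"
            using Nq[of n]
            by (simp add: E_def linear_cmul[OF lin[OF \<zeta>]] right_diff_distrib
                scaleR_conv_of_real[where 'a = complex])
          then have "dist (of_real (N n) * (\<psi> (k + v /\<^sub>R N n) \<zeta> - \<psi> k \<zeta>)) (D \<zeta> v) = N n * norm (E (v /\<^sub>R N n) \<zeta>)"
            using Nq[of n] by (simp add: dist_norm norm_mult)
          also have "\<dots> \<le> N n * (C * norm (v /\<^sub>R N n) ^ 2)"
            using Nq[of n] by (intro mult_left_mono E[OF small \<zeta>]) auto
          also have "\<dots> = C * norm v ^ 2 / N n"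
            using Nq[of n] by (simp add: field_simps power2_eq_square)
          also have "\<dots> = C * norm v ^ 2 / q * inverse (real (Suc n))"
            by (simp add: N_def field_simps)
          also have "\<dots> < \<epsilon>" by (rule n)
          finally show "dist (of_real (N n) * (\<psi> (k + v /\<^sub>R N n) \<zeta> - \<psi> k \<zeta>)) (D \<zeta> v) < \<epsilon>" .
        qed
      qed
      then show "\<exists>d. 0 < d \<and> cball x d \<subseteq> ball 0 r \<and> uniform_limit (cball x d)
          (\<lambda>n \<zeta>. of_real (N n) * (\<psi> (k + v /\<^sub>R N n) \<zeta> - \<psi> k \<zeta>)) (\<lambda>\<zeta>. D \<zeta> v) sequentially"
        if "x \<in> ball 0 r" for x
        using that open_contains_cball[of "ball (0::complex) r"] uniform_limit_on_subset
        by (meson open_ball)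
    qed simp
  qed
  \<comment> \<open>The candidate derivative takes the mixed second derivative in the other order:
    first in \<open>z\<close>, then in \<zeta>.\<close>
  define L where "L = (\<lambda>v. deriv (\<lambda>\<zeta>. D \<zeta> v) 0)"
  have z0: "(0::complex) \<in> ball 0 r" using r by simp
  have LD: "((\<lambda>\<zeta>. D \<zeta> v) has_field_derivative L v) (at 0)" for v
    unfolding L_def by (rule holomorphic_derivI[OF holD _ z0]) simp
  have "linear L"
  proof (rule linearI)
    fix x y c
    have "((\<lambda>\<zeta>. D \<zeta> (x + y)) has_field_derivative L x + L y) (at 0)"
      by (rule has_field_derivative_transform_within_open[OF DERIV_add[OF LD[of x] LD[of y]] open_ball z0])
        (simp add: linear_add[OF lin])
    then show "L (x + y) = L x + L y" using LD DERIV_unique by blast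
    have "((\<lambda>\<zeta>. D \<zeta> (c *\<^sub>R x)) has_field_derivative of_real c * L x) (at 0)"
      by (rule has_field_derivative_transform_within_open[OF DERIV_cmult[OF LD[of x]] open_ball z0])
        (simp add: linear_cmul[OF lin] scaleR_conv_of_real[where 'a = complex])
    then show "L (c *\<^sub>R x) = c *\<^sub>R L x" using LD DERIV_unique by (metis scaleR_conv_of_real)
  qed
  have est: "norm (deriv (\<psi> (k + v)) 0 - deriv (\<psi> k) 0 - L v) \<le> 2 * C / r * norm v ^ 2"
    if v: "norm v < r / 2" for v
  proof -
    have kv: "k + v \<in> ball k r" "k \<in> ball k r" using v r by (auto simp: dist_norm)
    have holE: "E v holomorphic_on ball 0 r"
      unfolding E_def using hol2[OF kv(1)] hol2[OF kv(2)] holD by (intro holomorphic_intros) auto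
    have "deriv (E v) 0 = deriv (\<psi> (k + v)) 0 - deriv (\<psi> k) 0 - L v"
      unfolding E_def
      by (intro DERIV_imp_deriv DERIV_diff LD holomorphic_derivI[OF hol2 _ z0]) (use kv in auto)
    moreover have "norm ((deriv ^^ 1) (E v) 0) \<le> fact 1 * (C * norm v ^ 2) / (r / 2) ^ 1"
    proof (rule Cauchy_inequality)
      show "E v holomorphic_on ball 0 (r / 2)"
        using r by (intro holomorphic_on_subset[OF holE]) auto
      have "cball 0 (r / 2) \<subseteq> ball (0::complex) r" using r by auto
      then show "continuous_on (cball 0 (r / 2)) (E v)"
        using holE continuous_on_subset holomorphic_on_imp_continuous_on by blast
    qed (use r E[OF v] in auto)
    ultimately show ?thesis by (simp add: mult_ac)
  qed
  have "((\<lambda>z. deriv (\<psi> z) 0) has_derivative L) (at k)"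
  proof (rule has_derivativeI_sandwich)
    show "0 < r / 2" using r by simp
    show "bounded_linear L" using \<open>linear L\<close> by (simp add: linear_conv_bounded_linear)
    show "norm (deriv (\<psi> y) 0 - deriv (\<psi> k) 0 - L (y - k)) / norm (y - k) \<le> 2 * C / r * norm (y - k)"
      if "y \<noteq> k" "dist y k < r / 2" for y
      using est[of "y - k"] that by (simp add: dist_norm divide_le_eq power2_eq_square mult.assoc)
    have "((\<lambda>y. 2 * C / r * norm (y - k)) \<longlongrightarrow> 2 * C / r * norm (k - k)) (at k)"
      by (intro tendsto_intros)
    then show "((\<lambda>y. 2 * C / r * norm (y - k)) \<longlongrightarrow> 0) (at k)" by simp
  qed
  then show ?thesis by (auto simp: differentiable_def)
qed

lemma differentiable_vec:
  fixes f :: "'a::real_normed_vector \<Rightarrow> complex ^ 'm"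
  assumes "\<And>i. (\<lambda>x. f x $ i) differentiable (at a)"
  shows "f differentiable (at a)"
proof -
  have "linear (axis i :: complex \<Rightarrow> complex ^ 'm)" for i
    by (rule linearI) (auto simp: vec_eq_iff axis_def)
  then have bl: "bounded_linear (axis i :: complex \<Rightarrow> complex ^ 'm)" for i
    by (simp add: linear_conv_bounded_linear)
  have "(\<lambda>x. \<Sum>i\<in>UNIV. axis i (f x $ i)) differentiable (at a)"
    by (intro differentiable_sum ballI differentiable_compose[of "axis _", OF _ assms]
        bounded_linear_imp_differentiable bl finite)
  moreover have "(\<Sum>i\<in>UNIV. axis i (f x $ i)) = f x" for x
    by (simp add: vec_eq_iff axis_def if_distrib cong: if_cong)
  ultimately show ?thesis by simp
qed

section \<open>Adjoint representation and bracket in a chart\<close>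

text \<open>Additivity of \<open>F'\<close> is part of being a derivative, so complex linearity
  reduces to homogeneity.\<close>

definition holomorphic_derivative ::
  "(complex \<Rightarrow> 'a \<Rightarrow> 'a) \<Rightarrow> ('a::real_normed_vector \<Rightarrow> complex ^ 'n) \<Rightarrow> ('a \<Rightarrow> complex ^ 'n) \<Rightarrow> 'a \<Rightarrow> bool"
  where "holomorphic_derivative s F F' z \<longleftrightarrow>
    (F has_derivative F') (at z) \<and> (\<forall>c x. F' (s c x) = c *s F' x)"

lemma complex_differentiable_atE:
  assumes "complex_differentiable_at s (*s) F z"
  obtains F' where "holomorphic_derivative s F F' z"
  using assms unfolding complex_differentiable_at_def holomorphic_derivative_def
  by (auto simp: Vector_Spaces.linear_iff)

locale complex_lie_chart =
  fixes G :: "'g :: {t2_space, second_countable_topology} monoid" (structure)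
    and A :: "('g, 'n :: finite) chart set"
    and K :: "('g, 'n) chart"
  assumes lie_group: "complex_lie_group G A"
    and chart: "K \<in> A" "\<one> \<in> dom_of K"
begin

abbreviation origin :: "complex ^ 'n" where "origin \<equiv> coord K \<one>"

abbreviation bracket :: "complex ^ 'n \<Rightarrow> complex ^ 'n \<Rightarrow> complex ^ 'n"
  where "bracket \<equiv> lie_bracket G K"

sublocale group G
  using lie_group by (simp add: complex_lie_group_def)

lemma carrier_eq_UNIV [simp]: "carrier G = UNIV"
  using lie_group by (simp add: complex_lie_group_def)

lemma inv_mult_eq: "inv\<^bsub>G\<^esub> (x \<otimes> y) = inv\<^bsub>G\<^esub> y \<otimes> inv\<^bsub>G\<^esub> x"
  by (rule inv_mult_group) simp_all

lemma assoc: "x \<otimes> y \<otimes> z = x \<otimes> (y \<otimes> z)"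
  by (rule m_assoc) simp_all

lemma obtain_chart:
  obtains L where "L \<in> A" "x \<in> dom_of L"
proof -
  have "x \<in> (\<Union>L\<in>A. dom_of L)"
    using lie_group by (simp add: complex_lie_group_def complex_atlas_def)
  then show thesis using that by blast
qed

context
  fixes L assumes L: "L \<in> A"
begin

lemma is_chart: "is_chart L"
  using L lie_group by (simp add: complex_lie_group_def complex_atlas_def)

lemma open_dom: "open (dom_of L)" and open_coord_image: "open (coord L ` dom_of L)"
  using is_chart by (simp_all add: is_chart_def)

lemma coord_inv_coord [simp]: "x \<in> dom_of L \<Longrightarrow> coord_inv L (coord L x) = x"
  using is_chart by (auto simp: is_chart_def homeomorphism_def)

lemma isCont_coord: "x \<in> dom_of L \<Longrightarrow> isCont (coord L) x"
  using is_chart open_dom continuous_on_eq_continuous_at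
  by (auto simp: is_chart_def homeomorphism_def)

lemma isCont_coord_inv: "x \<in> dom_of L \<Longrightarrow> isCont (coord_inv L) (coord L x)"
  using is_chart open_coord_image continuous_on_eq_continuous_at
  by (fastforce simp: is_chart_def homeomorphism_def)

lemma tendsto_coord_inv:
  "x \<in> dom_of L \<Longrightarrow> (f \<longlongrightarrow> coord L x) F \<Longrightarrow> ((\<lambda>t. coord_inv L (f t)) \<longlongrightarrow> x) F"
  using isCont_tendsto_compose[OF isCont_coord_inv] by fastforce

lemma eventually_in_dom: "x \<in> dom_of L \<Longrightarrow> (f \<longlongrightarrow> x) F \<Longrightarrow> \<forall>\<^sub>F t in F. f t \<in> dom_of L"
  using open_dom by (rule topological_tendstoD[rotated])

end

section \<open>Limits and holomorphy of the group operations in charts\<close>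

lemma tendsto_group_mult:
  assumes "(f \<longlongrightarrow> x) F" "(g \<longlongrightarrow> y) F"
  shows "((\<lambda>t. f t \<otimes> g t) \<longlongrightarrow> x \<otimes> y) F"
proof -
  have "isCont (\<lambda>(x, y). x \<otimes> y) (x, y)"
    using lie_group by (simp add: complex_lie_group_def continuous_on_eq_continuous_at)
  from isCont_tendsto_compose[OF this tendsto_Pair[OF assms]] show ?thesis by simp
qed

lemma tendsto_group_inv:
  assumes "(f \<longlongrightarrow> x) F"
  shows "((\<lambda>t. inv\<^bsub>G\<^esub> (f t)) \<longlongrightarrow> inv\<^bsub>G\<^esub> x) F"
proof -
  have "isCont (\<lambda>x. inv\<^bsub>G\<^esub> x) x"
    using lie_group by (simp add: complex_lie_group_def continuous_on_eq_continuous_at)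
  from isCont_tendsto_compose[OF this assms] show ?thesis .
qed

lemma holomorphic_mult:
  assumes "L \<in> A" "M \<in> A" "N \<in> A" "x \<in> dom_of L" "y \<in> dom_of M" "x \<otimes> y \<in> dom_of N"
  obtains D where "holomorphic_derivative scale_pair
    (\<lambda>(z, w). coord N (coord_inv L z \<otimes> coord_inv M w)) D (coord L x, coord M y)"
  using assms lie_group unfolding complex_lie_group_def by (blast elim: complex_differentiable_atE)

lemma holomorphic_inv:
  assumes "L \<in> A" "M \<in> A" "x \<in> dom_of L" "inv\<^bsub>G\<^esub> x \<in> dom_of M"
  obtains D where "holomorphic_derivative (*s) (\<lambda>z. coord M (inv\<^bsub>G\<^esub> (coord_inv L z))) D (coord L x)"
  using assms lie_group unfolding complex_lie_group_def by (blast elim: complex_differentiable_atE)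

text \<open>Chain rule through charts \<open>N\<close> and \<open>P\<close> around the intermediate
  values \<open>g \<otimes> y\<close> and \<open>inv g\<close>. The composite agrees with
  conjugation only near the point, where these values stay in their charts. Both variables are kept:
  the derivative in \<open>w\<close> yields \<open>Ad\<close>, the one in \<open>z\<close> its
  dependence on the group element.\<close>

lemma holomorphic_conj:
  assumes L: "L \<in> A" "g \<in> dom_of L" and y: "y \<in> dom_of K" "g \<otimes> y \<otimes> inv\<^bsub>G\<^esub> g \<in> dom_of K"
  obtains D where "holomorphic_derivative scale_pair
    (\<lambda>(z, w). coord K (coord_inv L z \<otimes> coord_inv K w \<otimes> inv\<^bsub>G\<^esub> (coord_inv L z))) D (coord L g, coord K y)"
proof -
  obtain N where N: "N \<in> A" "g \<otimes> y \<in> dom_of N" by (rule obtain_chart)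
  obtain P where P: "P \<in> A" "inv\<^bsub>G\<^esub> g \<in> dom_of P" by (rule obtain_chart)
  obtain Q where Q: "holomorphic_derivative scale_pair
      (\<lambda>(z, w). coord N (coord_inv L z \<otimes> coord_inv K w)) Q (coord L g, coord K y)"
    using holomorphic_mult[OF L(1) chart(1) N(1) L(2) y(1) N(2)] .
  obtain R where R: "holomorphic_derivative (*s) (\<lambda>z. coord P (inv\<^bsub>G\<^esub> (coord_inv L z))) R (coord L g)"
    using holomorphic_inv[OF L(1) P(1) L(2) P(2)] .
  obtain T where T: "holomorphic_derivative scale_pair
      (\<lambda>(z, w). coord K (coord_inv N z \<otimes> coord_inv P w)) T (coord N (g \<otimes> y), coord P (inv\<^bsub>G\<^esub> g))"
    using holomorphic_mult[OF N(1) P(1) chart(1) N(2) P(2) y(2)] .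
  let ?p = "(coord L g, coord K y)"
  let ?inner = "\<lambda>p. ((\<lambda>(z, w). coord N (coord_inv L z \<otimes> coord_inv K w)) p, coord P (inv\<^bsub>G\<^esub> (coord_inv L (fst p))))"
  let ?outer = "\<lambda>(z, w). coord K (coord_inv N z \<otimes> coord_inv P w)"
  let ?D = "\<lambda>p. T (Q p, R (fst p))"
  have "((\<lambda>p. coord P (inv\<^bsub>G\<^esub> (coord_inv L (fst p)))) has_derivative (\<lambda>p. R (fst p))) (at ?p)"
    using R by (intro has_derivative_compose[OF has_derivative_fst[OF has_derivative_ident]])
      (auto simp: holomorphic_derivative_def)
  then have inner: "(?inner has_derivative (\<lambda>p. (Q p, R (fst p)))) (at ?p)"
    using Q by (intro has_derivative_Pair) (auto simp: holomorphic_derivative_def)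
  have "((\<lambda>p. ?outer (?inner p)) has_derivative ?D) (at ?p)"
    by (rule has_derivative_compose[OF inner]) (use T L y chart in \<open>simp add: holomorphic_derivative_def\<close>)
  moreover have "\<forall>\<^sub>F p in at ?p. ?outer (?inner p) =
      (\<lambda>(z, w). coord K (coord_inv L z \<otimes> coord_inv K w \<otimes> inv\<^bsub>G\<^esub> (coord_inv L z))) p"
  proof -
    have fst: "((\<lambda>p. coord_inv L (fst p)) \<longlongrightarrow> g) (at ?p)"
      using L by (intro tendsto_coord_inv) (auto intro!: tendsto_eq_intros)
    have snd: "((\<lambda>p. coord_inv K (snd p)) \<longlongrightarrow> y) (at ?p)"
      using chart y by (intro tendsto_coord_inv) (auto intro!: tendsto_eq_intros)
    have "\<forall>\<^sub>F p in at ?p. coord_inv L (fst p) \<otimes> coord_inv K (snd p) \<in> dom_of N"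
      by (rule eventually_in_dom[OF N tendsto_group_mult[OF fst snd]])
    moreover have "\<forall>\<^sub>F p in at ?p. inv\<^bsub>G\<^esub> (coord_inv L (fst p)) \<in> dom_of P"
      by (rule eventually_in_dom[OF P tendsto_group_inv[OF fst]])
    ultimately show ?thesis
      by eventually_elim (simp add: split_beta N(1) P(1))
  qed
  ultimately have "((\<lambda>(z, w). coord K (coord_inv L z \<otimes> coord_inv K w \<otimes> inv\<^bsub>G\<^esub> (coord_inv L z)))
      has_derivative ?D) (at ?p)"
    by (rule has_derivative_transform_eventually) (use L y chart N P in simp_all)
  moreover have "?D (scale_pair c p) = c *s ?D p" for c p
  proof -
    have "?D (scale_pair c p) = T (scale_pair c (Q p, R (fst p)))"
      using Q R by (simp add: holomorphic_derivative_def scale_pair_def)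
    then show ?thesis using T by (simp add: holomorphic_derivative_def)
  qed
  ultimately show thesis using that unfolding holomorphic_derivative_def by blast
qed

text \<open>\<open>Ad\<close> is a choice of derivative, so differentiability must be shown before
  it means anything; it is the partial derivative of the conjugation map in its second variable.
  Afterwards \<open>Ad\<close> is computed by uniqueness of derivatives.\<close>

lemma has_derivative_Ad:
  "((\<lambda>z. coord K (g \<otimes> coord_inv K z \<otimes> inv\<^bsub>G\<^esub> g)) has_derivative Ad G K g) (at origin)"
proof -
  obtain L where L: "L \<in> A" "g \<in> dom_of L" by (rule obtain_chart)
  have one: "g \<otimes> \<one> \<otimes> inv\<^bsub>G\<^esub> g = \<one>" by simp
  obtain D where "holomorphic_derivative scale_pair
    (\<lambda>(z, w). coord K (coord_inv L z \<otimes> coord_inv K w \<otimes> inv\<^bsub>G\<^esub> (coord_inv L z))) D (coord L g, origin)"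
    using holomorphic_conj[OF L chart(2)] one chart(2) by auto
  then have D: "((\<lambda>(z, w). coord K (coord_inv L z \<otimes> coord_inv K w \<otimes> inv\<^bsub>G\<^esub> (coord_inv L z)))
      has_derivative D) (at (coord L g, origin))"
    by (simp add: holomorphic_derivative_def)
  have "((\<lambda>w. (coord L g, w)) has_derivative (\<lambda>w. (0, w))) (at origin)"
    by (auto intro!: derivative_eq_intros)
  from has_derivative_compose[OF this D]
  have "((\<lambda>w. coord K (g \<otimes> coord_inv K w \<otimes> inv\<^bsub>G\<^esub> g)) has_derivative (\<lambda>w. D (0, w))) (at origin)"
    using L by simp
  then show ?thesis
    unfolding Ad_def using frechet_derivative_works differentiableI by blast
qed

lemma linear_Ad: "linear (Ad G K g)"
  using has_derivative_Ad by (rule has_derivative_linear)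

lemmas Ad_linear_simps =
  linear_add[OF linear_Ad] linear_diff[OF linear_Ad] linear_cmul[OF linear_Ad]
  linear_neg[OF linear_Ad] linear_0[OF linear_Ad] linear_sum[OF linear_Ad]

lemma bounded_linear_Ad: "bounded_linear (Ad G K g)"
  using linear_Ad by (simp add: linear_conv_bounded_linear)

lemma Ad_one: "Ad G K \<one> X = X"
proof -
  have "((\<lambda>z. coord K (\<one> \<otimes> coord_inv K z \<otimes> inv\<^bsub>G\<^esub> \<one>)) has_derivative (\<lambda>z. z)) (at origin)"
  proof (rule has_derivative_transform_within_open[OF has_derivative_ident open_coord_image[OF chart(1)]])
    fix z assume "z \<in> coord K ` dom_of K"
    then show "z = coord K (\<one> \<otimes> coord_inv K z \<otimes> inv\<^bsub>G\<^esub> \<one>)"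
      using chart by auto
  qed (use chart in auto)
  then show ?thesis
    using has_derivative_unique[OF has_derivative_Ad] by metis
qed

lemma tendsto_conj:
  "((\<lambda>z. g \<otimes> coord_inv K z \<otimes> inv\<^bsub>G\<^esub> g) \<longlongrightarrow> \<one>) (at origin)"
proof -
  have "((\<lambda>z. coord_inv K z) \<longlongrightarrow> \<one>) (at origin)"
    using chart by (intro tendsto_coord_inv) auto
  then have "((\<lambda>z. g \<otimes> coord_inv K z \<otimes> inv\<^bsub>G\<^esub> g) \<longlongrightarrow> g \<otimes> \<one> \<otimes> inv\<^bsub>G\<^esub> g) (at origin)"
    by (intro tendsto_group_mult tendsto_const)
  then show ?thesis by simp
qed

text \<open>Conjugations compose, and so do their coordinate expressions as long as the inner value
  lies in \<open>dom_of K\<close>, which holds near the origin. The chain rule does the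
  rest.\<close>

lemma Ad_mult: "Ad G K (g \<otimes> g') X = Ad G K g (Ad G K g' X)"
proof -
  let ?f = "\<lambda>g z. coord K (g \<otimes> coord_inv K z \<otimes> inv\<^bsub>G\<^esub> g)"
  have f: "?f g origin = origin" for g using chart by simp
  have "((\<lambda>z. ?f g (?f g' z)) has_derivative (\<lambda>X. Ad G K g (Ad G K g' X))) (at origin)"
    by (rule has_derivative_compose[OF has_derivative_Ad]) (simp only: f has_derivative_Ad)
  moreover have "\<forall>\<^sub>F z in at origin. ?f g (?f g' z) = ?f (g \<otimes> g') z"
    using eventually_in_dom[OF chart tendsto_conj[of g']]
    by eventually_elim (simp add: chart inv_mult_eq assoc)
  ultimately have "(?f (g \<otimes> g') has_derivative (\<lambda>X. Ad G K g (Ad G K g' X))) (at origin)"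
    by (rule has_derivative_transform_eventually) (simp_all only: f UNIV_I)
  then show ?thesis
    using has_derivative_unique[OF has_derivative_Ad] by metis
qed

text \<open>Continuity at the identity provides one radius for both variables and one bound on
  conjugation, as required for applying Cauchy's inequality in
  \<open>differentiable_parametric_deriv\<close>.\<close>

lemma conj_box:
  obtains r M where "0 < r"
    "\<And>z w. z \<in> ball origin r \<Longrightarrow> w \<in> ball origin r \<Longrightarrow>
      z \<in> coord K ` dom_of K \<and> w \<in> coord K ` dom_of K \<and>
      coord_inv K z \<otimes> coord_inv K w \<otimes> inv\<^bsub>G\<^esub> (coord_inv K z) \<in> dom_of K \<and>
      norm (coord K (coord_inv K z \<otimes> coord_inv K w \<otimes> inv\<^bsub>G\<^esub> (coord_inv K z))) \<le> M"
proof -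
  let ?c = "\<lambda>p. coord_inv K (fst p) \<otimes> coord_inv K (snd p) \<otimes> inv\<^bsub>G\<^esub> (coord_inv K (fst p))"
  let ?N = "nhds (origin, origin)"
  have id: "((\<lambda>p. p) \<longlongrightarrow> (origin, origin)) ?N" by (rule filterlim_ident)
  have tf: "(fst \<longlongrightarrow> origin) ?N" and ts: "(snd \<longlongrightarrow> origin) ?N"
    using tendsto_fst[OF id] tendsto_snd[OF id] by simp_all
  have "(?c \<longlongrightarrow> \<one> \<otimes> \<one> \<otimes> inv\<^bsub>G\<^esub> \<one>) ?N"
    by (intro tendsto_group_mult tendsto_group_inv tendsto_coord_inv chart tf ts)
  then have c: "(?c \<longlongrightarrow> \<one>) ?N" by simp
  have "((\<lambda>p. norm (coord K (?c p))) \<longlongrightarrow> norm origin) ?N"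
    by (intro tendsto_norm isCont_tendsto_compose[OF isCont_coord[OF chart] c])
  then have "\<forall>\<^sub>F p in ?N. norm (coord K (?c p)) < norm origin + 1"
    by (rule order_tendstoD) simp
  moreover have "\<forall>\<^sub>F p in ?N. ?c p \<in> dom_of K"
    by (rule eventually_in_dom[OF chart c])
  moreover have "\<forall>\<^sub>F p in ?N. fst p \<in> coord K ` dom_of K" "\<forall>\<^sub>F p in ?N. snd p \<in> coord K ` dom_of K"
    using chart by (auto intro!: topological_tendstoD[OF tf] topological_tendstoD[OF ts] open_coord_image)
  ultimately have "\<forall>\<^sub>F p in ?N. fst p \<in> coord K ` dom_of K \<and> snd p \<in> coord K ` dom_of K \<and>
      ?c p \<in> dom_of K \<and> norm (coord K (?c p)) \<le> norm origin + 1"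
    by eventually_elim simp
  then obtain d where d: "0 < d" "\<And>p. dist p (origin, origin) < d \<Longrightarrow>
      fst p \<in> coord K ` dom_of K \<and> snd p \<in> coord K ` dom_of K \<and>
      ?c p \<in> dom_of K \<and> norm (coord K (?c p)) \<le> norm origin + 1"
    unfolding eventually_nhds_metric by blast
  \<comment> \<open>The distance of pairs is at most the sum of the two distances, so each variable
    may use half of \<open>d\<close>.\<close>
  show thesis
  proof (rule that[of "d / 2" "norm origin + 1"])
    show "0 < d / 2" using d by simp
    fix z w assume "z \<in> ball origin (d / 2)" "w \<in> ball origin (d / 2)"
    then have "dist (z, w) (origin, origin) < d"
      using sqrt_sum_squares_le_sum[of "dist z origin" "dist w origin"]
      by (simp add: dist_Pair_Pair dist_commute)
    from d(2)[OF this] show "z \<in> coord K ` dom_of K \<and> w \<in> coord K ` dom_of K \<and>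
      coord_inv K z \<otimes> coord_inv K w \<otimes> inv\<^bsub>G\<^esub> (coord_inv K z) \<in> dom_of K \<and>
      norm (coord K (coord_inv K z \<otimes> coord_inv K w \<otimes> inv\<^bsub>G\<^esub> (coord_inv K z))) \<le> norm origin + 1"
      by simp
  qed
qed

text \<open>Coordinate by coordinate, \<open>Ad G K (coord_inv K z) Y\<close> is the derivative at
  \<zeta> = 0 of conjugation applied to the point with coordinates
  \<open>origin + \<zeta> *s Y\<close>. Differentiability in \<open>z\<close> is thus an instance of
  \<open>differentiable_parametric_deriv\<close>.\<close>

lemma differentiable_Ad_coord_inv: "(\<lambda>z. Ad G K (coord_inv K z) Y) differentiable (at origin)"
proof (rule differentiable_vec)
  fix i
  define \<Phi> where "\<Phi> = (\<lambda>(z, w). coord K (coord_inv K z \<otimes> coord_inv K w \<otimes> inv\<^bsub>G\<^esub> (coord_inv K z)))"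
  obtain r M where r: "0 < r" and box:
    "\<And>z w. z \<in> ball origin r \<Longrightarrow> w \<in> ball origin r \<Longrightarrow>
      z \<in> coord K ` dom_of K \<and> w \<in> coord K ` dom_of K \<and>
      coord_inv K z \<otimes> coord_inv K w \<otimes> inv\<^bsub>G\<^esub> (coord_inv K z) \<in> dom_of K \<and>
      norm (\<Phi> (z, w)) \<le> M"
    using conj_box unfolding \<Phi>_def prod.case by blast
  have "\<exists>D. holomorphic_derivative scale_pair \<Phi> D (z, w)"
    if "z \<in> ball origin r" "w \<in> ball origin r" for z w
  proof -
    from box[OF that] obtain x y where xy: "x \<in> dom_of K" "y \<in> dom_of K" "z = coord K x" "w = coord K y"
      by auto
    then have "x \<otimes> y \<otimes> inv\<^bsub>G\<^esub> x \<in> dom_of K" using box[OF that] chart by simp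
    from holomorphic_conj[OF chart(1) xy(1,2) this] show ?thesis
      unfolding \<Phi>_def xy(3,4) by blast
  qed
  then obtain D where D: "\<And>z w. z \<in> ball origin r \<Longrightarrow> w \<in> ball origin r \<Longrightarrow>
      holomorphic_derivative scale_pair \<Phi> (D z w) (z, w)"
    by metis
  have der: "(\<Phi> has_derivative D z w) (at (z, w))"
    if "z \<in> ball origin r" "w \<in> ball origin r" for z w
    using D[OF that] by (simp add: holomorphic_derivative_def)
  \<comment> \<open>Complex homogeneity of \<open>D z w\<close> turns the real derivative of \<Phi>
    into a complex derivative along every complex line.\<close>
  have line: "((\<lambda>s. \<Phi> (z + s *s u, w + s *s v) $ i) has_field_derivative D z w (u, v) $ i) (at 0)"
    if "z \<in> ball origin r" "w \<in> ball origin r" for z w u v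
  proof -
    have "linear (\<lambda>s. (s *s u, s *s v))"
      by (rule linearI) (simp_all add: vec_eq_iff algebra_simps scaleR_conv_of_real[where 'a = complex])
    from has_derivative_add[OF has_derivative_const[of "(z, w)"] linear_imp_has_derivative[OF this]]
    have "((\<lambda>s. (z + s *s u, w + s *s v)) has_derivative (\<lambda>s. (s *s u, s *s v))) (at 0)"
      by simp
    from has_derivative_compose[OF this, of \<Phi> "D z w"] der[OF that]
    have "((\<lambda>s. \<Phi> (z + s *s u, w + s *s v)) has_derivative (\<lambda>s. D z w (s *s u, s *s v))) (at 0)"
      by simp
    moreover have "D z w (s *s u, s *s v) = s *s D z w (u, v)" for s
      using D[OF that] by (simp add: holomorphic_derivative_def scale_pair_def)
    ultimately have "((\<lambda>s. \<Phi> (z + s *s u, w + s *s v)) has_derivative (\<lambda>s. s *s D z w (u, v))) (at 0)"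
      by simp
    from bounded_linear.has_derivative[OF bounded_linear_vec_nth[of i] this] show ?thesis
      by (simp add: has_field_derivative_def mult.commute[of _ "_ $ _"])
  qed
  \<comment> \<open>A smaller radius for which \<open>origin + \<zeta> *s Y\<close> stays in the
    box; the summand 1 covers \<open>Y = 0\<close> and gives \<open>q \<le> r\<close>.\<close>
  define q where "q = r / (1 + norm Y)"
  have q: "0 < q" "q \<le> r" using r by (auto simp: q_def field_simps add_pos_nonneg)
  have inY: "origin + \<zeta> *s Y \<in> ball origin r" if "\<zeta> \<in> ball 0 q" for \<zeta>
  proof -
    have "norm \<zeta> * norm Y \<le> norm \<zeta> * (1 + norm Y)" by (simp add: mult_left_mono)
    also have "\<dots> < r" using that by (simp add: q_def field_simps add_pos_nonneg)
    finally show ?thesis by (simp add: dist_norm norm_vector_scale_complex)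
  qed
  have inz: "z \<in> ball origin r" if "z \<in> ball origin q" for z using that q by auto
  define \<psi> where "\<psi> = (\<lambda>z \<zeta>. \<Phi> (z, origin + \<zeta> *s Y) $ i)"
  have "(\<lambda>z. deriv (\<psi> z) 0) differentiable (at origin)"
  proof (rule differentiable_parametric_deriv[OF q(1)])
    fix \<zeta> :: complex and z assume \<zeta>: "\<zeta> \<in> ball 0 q" and z: "z \<in> ball origin q"
    show "norm (\<psi> z \<zeta>) \<le> M"
      using box[OF inz[OF z] inY[OF \<zeta>]] order_trans[OF Finite_Cartesian_Product.norm_nth_le]
      unfolding \<psi>_def by blast
    show "(\<lambda>s. \<psi> (z + s *s v) \<zeta>) field_differentiable (at 0)" for v
      using line[OF inz[OF z] inY[OF \<zeta>], of v 0] by (auto simp: \<psi>_def field_differentiable_def)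
  next
    fix z assume z: "z \<in> ball origin q"
    show "\<psi> z holomorphic_on ball 0 q"
      unfolding holomorphic_on_def
    proof
      fix \<zeta> :: complex assume \<zeta>: "\<zeta> \<in> ball 0 q"
      have "((\<lambda>s. \<psi> z (s + \<zeta>)) has_field_derivative D z (origin + \<zeta> *s Y) (0, Y) $ i) (at 0)"
        using line[OF inz[OF z] inY[OF \<zeta>], of 0 Y]
        by (simp add: \<psi>_def vector_sadd_rdistrib algebra_simps)
      then show "\<psi> z field_differentiable at \<zeta> within ball 0 q"
        using DERIV_shift[of "\<psi> z" _ 0 \<zeta>]
        by (auto simp: field_differentiable_def intro: has_field_derivative_at_within)
    qed
  next
    fix \<zeta> :: complex assume \<zeta>: "\<zeta> \<in> ball 0 q"
    have o: "origin \<in> ball origin r" using r by simp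
    have "((\<lambda>z. (z, origin + \<zeta> *s Y)) has_derivative (\<lambda>v. (v, 0))) (at origin)"
      by (auto intro!: derivative_eq_intros)
    from has_derivative_compose[OF this der[OF o inY[OF \<zeta>]]]
    show "((\<lambda>z. \<psi> z \<zeta>) has_derivative (\<lambda>v. D origin (origin + \<zeta> *s Y) (v, 0) $ i)) (at origin)"
      unfolding \<psi>_def by (rule bounded_linear.has_derivative[OF bounded_linear_vec_nth])
  qed
  then obtain T where T: "((\<lambda>z. deriv (\<psi> z) 0) has_derivative T) (at origin)"
    by (auto simp: differentiable_def)
  have "((\<lambda>z. Ad G K (coord_inv K z) Y $ i) has_derivative T) (at origin)"
  proof (rule has_derivative_transform_within_open[OF T open_ball])
    show "origin \<in> ball origin r" using r by simp
    fix z assume z: "z \<in> ball origin r"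
    have o: "origin \<in> ball origin r" using r by simp
    have "((\<lambda>w. (z, w)) has_derivative (\<lambda>v. (0, v))) (at origin)"
      by (auto intro!: derivative_eq_intros)
    from has_derivative_compose[OF this der[OF z o]]
    have "((\<lambda>w. coord K (coord_inv K z \<otimes> coord_inv K w \<otimes> inv\<^bsub>G\<^esub> (coord_inv K z)))
        has_derivative (\<lambda>v. D z origin (0, v))) (at origin)"
      by (simp add: \<Phi>_def)
    then have "Ad G K (coord_inv K z) Y = D z origin (0, Y)"
      using has_derivative_unique[OF has_derivative_Ad] by metis
    then show "deriv (\<psi> z) 0 = Ad G K (coord_inv K z) Y $ i"
      using line[OF z o, of 0 Y] by (simp add: \<psi>_def DERIV_imp_deriv)
  qed
  then show "(\<lambda>z. Ad G K (coord_inv K z) Y $ i) differentiable (at origin)"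
    by (auto simp: differentiable_def)
qed


section \<open>The bracket as a bilinear derivative, and derivatives along curves\<close>

lemma has_derivative_bracket:
  "((\<lambda>z. Ad G K (coord_inv K z) Y) has_derivative (\<lambda>X. bracket X Y)) (at origin)"
  using differentiable_Ad_coord_inv[of Y] unfolding lie_bracket_def frechet_derivative_works .

lemma linear_bracket_left: "linear (\<lambda>X. bracket X Y)"
  using has_derivative_bracket by (rule has_derivative_linear)

lemma linear_bracket_right: "linear (bracket X)"
proof (rule linearI)
  fix Y Y' and c :: real
  have "((\<lambda>z. Ad G K (coord_inv K z) (Y + Y')) has_derivative (\<lambda>X. bracket X Y + bracket X Y')) (at origin)"
    unfolding Ad_linear_simps by (intro has_derivative_add has_derivative_bracket)
  from fun_cong[OF has_derivative_unique[OF has_derivative_bracket this]]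
  show "bracket X (Y + Y') = bracket X Y + bracket X Y'" .
  have "((\<lambda>z. Ad G K (coord_inv K z) (c *\<^sub>R Y)) has_derivative (\<lambda>X. c *\<^sub>R bracket X Y)) (at origin)"
    unfolding Ad_linear_simps by (intro has_derivative_scaleR_right has_derivative_bracket)
  from fun_cong[OF has_derivative_unique[OF has_derivative_bracket this]]
  show "bracket X (c *\<^sub>R Y) = c *\<^sub>R bracket X Y" .
qed

sublocale bracket: bounded_bilinear bracket
  unfolding bilinear_conv_bounded_bilinear[symmetric] bilinear_def
  by (simp add: linear_bracket_left linear_bracket_right)

lemmas bracket_simps = bracket.add_left bracket.add_right bracket.diff_left bracket.diff_right
  bracket.minus_left bracket.minus_right bracket.scaleR_left bracket.scaleR_right

text \<open>The velocity of \<open>c\<close> is known only in coordinates. Continuity of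
  \<open>c\<close> at 0 keeps \<open>c t\<close> in \<open>dom_of K\<close> for small
  \<open>t\<close>, where passing to coordinates and back changes nothing, so the chain rule
  applies.\<close>

lemma has_vector_derivative_along_curve:
  fixes c :: "real \<Rightarrow> 'g"
  assumes c: "c 0 = \<one>" "isCont c 0" "((\<lambda>t. coord K (c t)) has_vector_derivative X) (at 0)"
    and F: "((\<lambda>z. F (coord_inv K z)) has_derivative F') (at origin)"
  shows "((\<lambda>t. F (c t)) has_vector_derivative F' X) (at 0)"
proof -
  have "((\<lambda>z. F (coord_inv K z)) has_derivative F') (at (coord K (c 0)) within range (\<lambda>t. coord K (c t)))"
    using F c(1) by (simp add: has_derivative_at_withinI)
  from vector_derivative_diff_chain_within[OF c(3) this]
  have "((\<lambda>t. F (coord_inv K (coord K (c t)))) has_derivative (\<lambda>t. t *\<^sub>R F' X)) (at 0)"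
    by (simp add: has_vector_derivative_def o_def)
  moreover have "\<forall>\<^sub>F t in at 0. F (coord_inv K (coord K (c t))) = F (c t)"
    using eventually_in_dom[OF chart, of c "at 0"] c(1,2)
    unfolding isCont_def by (auto simp: chart(1) elim!: eventually_mono)
  ultimately show ?thesis
    unfolding has_vector_derivative_def
    by (rule has_derivative_transform_eventually) (use c(1) chart in simp_all)
qed

lemmas has_vector_derivative_Ad_along_curve =
  has_vector_derivative_along_curve[where F = "\<lambda>x. Ad G K x Y" for Y, OF _ _ _ has_derivative_bracket]

lemmas has_vector_derivative_conj_curve =
  has_vector_derivative_along_curve[where F = "\<lambda>x. coord K (g \<otimes> x \<otimes> inv\<^bsub>G\<^esub> g)" for g,
    OF _ _ _ has_derivative_Ad]

lemma group_action_Ad: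
  assumes "group H" "\<phi> \<in> hom H G"
  shows "group_action H UNIV (\<lambda>w. Ad G K (\<phi> w))"
proof -
  have bij: "bij (Ad G K g)" for g
  proof (rule o_bij)
    show "Ad G K (inv\<^bsub>G\<^esub> g) \<circ> Ad G K g = id" "Ad G K g \<circ> Ad G K (inv\<^bsub>G\<^esub> g) = id"
      by (simp_all add: fun_eq_iff Ad_mult[symmetric] Ad_one)
  qed
  then have Bij: "Ad G K g \<in> Bij UNIV" for g by (simp add: Bij_def)
  have "(\<lambda>w. Ad G K (\<phi> w)) \<in> hom H (BijGroup UNIV)"
    using assms(2) Bij by (auto simp: hom_def BijGroup_def compose_def fun_eq_iff Ad_mult)
  then show ?thesis
    using assms(1) by (simp add: group_action_def group_hom_def group_hom_axioms_def group_BijGroup)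
qed

end

section \<open>The adjoint action of exponentials\<close>

locale complex_lie_exponential = complex_lie_chart G A K
  for G :: "'g :: {t2_space, second_countable_topology} monoid" (structure)
    and A :: "('g, 'n :: finite) chart set"
    and K :: "('g, 'n) chart" +
  fixes Exp :: "complex ^ 'n \<Rightarrow> 'g"
  assumes exponential: "exponential_map G K Exp"
begin

section \<open>Derivatives along one-parameter subgroups and the Lie algebra identities\<close>

lemma Exp_add: "Exp ((s + t) *\<^sub>R X) = Exp (s *\<^sub>R X) \<otimes> Exp (t *\<^sub>R X)"
  using exponential unfolding exponential_map_def one_parameter_subgroup_def by blast

lemma Exp_zero: "Exp (0 *\<^sub>R X) = \<one>"
  using Exp_add[where s = 0 and t = 0 and X = X] l_cancel_one[of "Exp (0 *\<^sub>R X)" "Exp (0 *\<^sub>R X)"] by simp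

lemma Exp_minus: "Exp (- X) \<otimes> Exp X = \<one>"
  using Exp_add[where s = "- 1" and t = 1 and X = X] Exp_zero[of X] by simp

lemma isCont_Exp: "isCont (\<lambda>t. Exp (t *\<^sub>R X)) t"
  using exponential continuous_on_eq_continuous_at[OF open_UNIV]
  unfolding exponential_map_def one_parameter_subgroup_def by blast

lemma Exp_velocity: "((\<lambda>t. coord K (Exp (t *\<^sub>R X))) has_vector_derivative X) (at 0)"
  using exponential unfolding exponential_map_def one_parameter_subgroup_def by blast

lemma has_vector_derivative_Ad_Exp_0:
  "((\<lambda>t. Ad G K (Exp (t *\<^sub>R X)) Y) has_vector_derivative bracket X Y) (at 0)"
  by (rule has_vector_derivative_Ad_along_curve[OF Exp_zero isCont_Exp Exp_velocity])

lemma Exp_conj_velocity: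
  "((\<lambda>t. coord K (g \<otimes> Exp (t *\<^sub>R X) \<otimes> inv\<^bsub>G\<^esub> g)) has_vector_derivative Ad G K g X) (at 0)"
  by (rule has_vector_derivative_conj_curve[OF Exp_zero isCont_Exp Exp_velocity])

lemma Ad_Exp_minus: "Ad G K (Exp (- X)) (Ad G K (Exp X) Y) = Y"
  by (simp add: Ad_mult[symmetric] Exp_minus Ad_one)

text \<open>The one-parameter property transports the derivative at 0 to time \<open>t\<close>.
  Keeping \<open>Ad\<close> outermost makes the derivative the same function for
  \<open>bracket X Y\<close> in place of \<open>Y\<close>, which suits induction on
  nilpotency.\<close>

lemma has_vector_derivative_Ad_Exp:
  "((\<lambda>t. Ad G K (Exp (t *\<^sub>R X)) Y) has_vector_derivative Ad G K (Exp (t *\<^sub>R X)) (bracket X Y)) (at t)"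
proof -
  \<comment> \<open>The base point 0 is written \<open>t - t\<close> to fit the chain rule with the
    shift \<open>u - t\<close>.\<close>
  have "((\<lambda>s. Ad G K (Exp (t *\<^sub>R X)) (Ad G K (Exp (s *\<^sub>R X)) Y)) has_vector_derivative
      Ad G K (Exp (t *\<^sub>R X)) (bracket X Y)) (at (t - t))"
    using bounded_linear.has_vector_derivative[OF bounded_linear_Ad has_vector_derivative_Ad_Exp_0] by simp
  then have "((\<lambda>s. Ad G K (Exp ((t + s) *\<^sub>R X)) Y) has_vector_derivative
      Ad G K (Exp (t *\<^sub>R X)) (bracket X Y)) (at (t - t))"
    by (simp only: Exp_add Ad_mult)
  moreover have "((\<lambda>u. u - t) has_vector_derivative 1) (at t)"
    by (auto intro!: derivative_eq_intros)
  ultimately show ?thesis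
    using vector_diff_chain_at[of "\<lambda>u. u - t" 1 t "\<lambda>s. Ad G K (Exp ((t + s) *\<^sub>R X)) Y"] by (simp add: o_def)
qed

text \<open>Conjugating \<open>Exp (t *\<^sub>R X)\<close> by \<open>g\<close> gives a curve with
  velocity \<open>Ad G K g X\<close>. Its adjoint action on \<open>Ad G K g Y\<close>,
  differentiated at 0 directly and after multiplicativity of \<open>Ad\<close>, gives the two
  sides.\<close>

lemma Ad_bracket: "Ad G K g (bracket X Y) = bracket (Ad G K g X) (Ad G K g Y)"
proof -
  let ?c = "\<lambda>t. g \<otimes> Exp (t *\<^sub>R X) \<otimes> inv\<^bsub>G\<^esub> g"
  have "isCont ?c 0"
    using isCont_Exp[where X = X and t = 0] unfolding isCont_def by (intro tendsto_group_mult tendsto_const)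
  then have "((\<lambda>t. Ad G K (?c t) (Ad G K g Y)) has_vector_derivative bracket (Ad G K g X) (Ad G K g Y)) (at 0)"
    using Exp_zero[of X] by (intro has_vector_derivative_Ad_along_curve Exp_conj_velocity) simp_all
  moreover have "Ad G K (?c t) (Ad G K g Y) = Ad G K g (Ad G K (Exp (t *\<^sub>R X)) Y)" for t
  proof -
    have "?c t \<otimes> g = g \<otimes> Exp (t *\<^sub>R X)" by (simp add: assoc)
    then show ?thesis by (metis Ad_mult)
  qed
  moreover have "((\<lambda>t. Ad G K g (Ad G K (Exp (t *\<^sub>R X)) Y)) has_vector_derivative Ad G K g (bracket X Y)) (at 0)"
    by (rule bounded_linear.has_vector_derivative[OF bounded_linear_Ad has_vector_derivative_Ad_Exp_0])
  ultimately show ?thesis using vector_derivative_unique_at by fastforce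
qed

text \<open>The elements \<open>Exp (t *\<^sub>R X)\<close> and \<open>Exp (s *\<^sub>R X)\<close>
  commute, so conjugation by the first fixes the curve in \<open>s\<close> and hence its velocity
  \<open>X\<close>. The bracket is then the derivative of a constant.\<close>

lemma bracket_self: "bracket X X = 0"
proof -
  have "Ad G K (Exp (t *\<^sub>R X)) X = X" for t
  proof -
    have "Exp (t *\<^sub>R X) \<otimes> Exp (s *\<^sub>R X) \<otimes> inv\<^bsub>G\<^esub> (Exp (t *\<^sub>R X)) = Exp (s *\<^sub>R X)" for s
    proof -
      have "Exp (t *\<^sub>R X) \<otimes> Exp (s *\<^sub>R X) = Exp (s *\<^sub>R X) \<otimes> Exp (t *\<^sub>R X)"
        by (metis Exp_add add.commute)
      then show ?thesis by (simp add: assoc)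
    qed
    then show ?thesis
      using Exp_conj_velocity[of "Exp (t *\<^sub>R X)" X] Exp_velocity[of X] vector_derivative_unique_at
      by simp
  qed
  then have "((\<lambda>t. X) has_vector_derivative bracket X X) (at (0::real))"
    using has_vector_derivative_Ad_Exp_0[of X X] by simp
  then show ?thesis using has_vector_derivative_const vector_derivative_unique_at by blast
qed

lemma bracket_antisym: "bracket X Y = - bracket Y X"
proof -
  have "bracket X Y + bracket Y X = 0"
    using bracket_self[of "X + Y"] unfolding bracket.add_left bracket.add_right
    by (simp add: bracket_self add.commute)
  then show ?thesis by (simp only: eq_neg_iff_add_eq_0)
qed

text \<open>This is the product rule applied to \<open>Ad_bracket\<close> along
  \<open>Exp (t *\<^sub>R Z)\<close> at 0.\<close>

lemma bracket_Jacobi: "bracket Z (bracket X Y) = bracket (bracket Z X) Y + bracket X (bracket Z Y)"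
proof -
  let ?A = "\<lambda>t. Ad G K (Exp (t *\<^sub>R Z))"
  have "((\<lambda>t. bracket (?A t X) (?A t Y)) has_vector_derivative
      bracket (?A 0 X) (bracket Z Y) + bracket (bracket Z X) (?A 0 Y)) (at 0)"
    by (intro bracket.has_vector_derivative has_vector_derivative_Ad_Exp_0)
  moreover have "((\<lambda>t. bracket (?A t X) (?A t Y)) has_vector_derivative bracket Z (bracket X Y)) (at 0)"
    unfolding Ad_bracket[symmetric] by (rule has_vector_derivative_Ad_Exp_0)
  moreover have "?A 0 W = W" for W using Exp_zero[of Z] by (simp add: Ad_one)
  ultimately show ?thesis using vector_derivative_unique_at by (fastforce simp: add.commute)
qed

text \<open>Induction with \<open>Y\<close> arbitrary replaces a uniqueness theorem for differential
  equations. The derivative of the left side is the left side for \<open>bracket X Y\<close>, which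
  one bracket fewer annihilates, so it is known. The two sides then differ by a constant that
  vanishes at 0.\<close>

lemma Ad_Exp_nilpotent:
  assumes "(bracket X ^^ k) Y = 0"
  shows "Ad G K (Exp (t *\<^sub>R X)) Y = (\<Sum>n<k. (t ^ n / fact n) *\<^sub>R (bracket X ^^ n) Y)"
  using assms
proof (induction k arbitrary: Y t)
  case 0
  then show ?case by (simp add: Ad_linear_simps)
next
  case (Suc k)
  let ?Z = "bracket X Y"
  let ?P = "\<lambda>t. Y + (\<Sum>n<k. (t ^ Suc n / fact (Suc n)) *\<^sub>R (bracket X ^^ n) ?Z)"
  let ?u = "\<lambda>t. Ad G K (Exp (t *\<^sub>R X)) Y - ?P t"
  have IH: "Ad G K (Exp (t *\<^sub>R X)) ?Z = (\<Sum>n<k. (t ^ n / fact n) *\<^sub>R (bracket X ^^ n) ?Z)" for t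
    by (rule Suc.IH) (use Suc.prems in \<open>simp add: funpow_swap1\<close>)
  have "((\<lambda>t. t ^ Suc n / fact (Suc n)) has_real_derivative t ^ n / fact n) (at t)" for n and t :: real
    using DERIV_cdivide[OF DERIV_pow[of "Suc n" t], of "fact (Suc n)"] by (simp del: of_nat_Suc)
  then have "(?P has_vector_derivative 0 + (\<Sum>n<k. (t ^ n / fact n) *\<^sub>R (bracket X ^^ n) ?Z)) (at t)" for t
    by (intro has_vector_derivative_add has_vector_derivative_const has_vector_derivative_sum
        has_vector_derivative_scaleR[where g' = 0, simplified] has_vector_derivative_const)
  then have "(?u has_vector_derivative 0) (at t)" for t
    using has_vector_derivative_diff[OF has_vector_derivative_Ad_Exp[of X Y t]] IH[of t] by fastforce
  then obtain c where c: "\<And>t. ?u t = c"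
    using has_vector_derivative_zero_constant[of UNIV ?u] by auto
  have "c = 0" using c[of 0] Exp_zero[of X] by (simp add: Ad_one)
  then have "Ad G K (Exp (t *\<^sub>R X)) Y = ?P t" using c[of t] by simp
  then show ?case
    by (simp add: sum.lessThan_Suc_shift funpow_swap1 del: sum.lessThan_Suc)
qed

section \<open>Exponential series on strings of an \<open>sl_2\<close>-triple\<close>

lemmas Ad_Exp_nilpotent_1 = Ad_Exp_nilpotent[where t = 1, simplified]

lemma Ad_Exp_fixed: "bracket X Y = 0 \<Longrightarrow> Ad G K (Exp X) Y = Y"
  using Ad_Exp_nilpotent_1[of 1 X Y] by simp

text \<open>\<open>V\<close> is a lowest weight vector of weight \<open>- m\<close>, and its string
  under \<open>E\<close> ends at the power \<open>m\<close>. Both \<open>e j\<close> and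
  \<open>f j\<close> fit this pattern, the latter with \<open>e i\<close> and \<open>f i\<close>
  exchanged and \<open>- h i\<close> for \<open>H\<close>.\<close>

context
  fixes E F H V and m :: nat
  assumes EF: "bracket E F = H" and HE: "bracket H E = 2 *\<^sub>R E"
    and FV: "bracket F V = 0" and HV: "bracket H V = - (real m *\<^sub>R V)"
    and EV: "(bracket E ^^ Suc m) V = 0"
begin

lemma weight_string: "bracket H ((bracket E ^^ n) V) = (2 * real n - real m) *\<^sub>R (bracket E ^^ n) V"
proof (induction n)
  case (Suc n)
  show ?case
    by (simp add: bracket_Jacobi[of H E] HE Suc.IH bracket_simps flip: scaleR_left_distrib)
qed (simp add: HV)

text \<open>Moving \<open>F\<close> past one \<open>E\<close> adds the negative of the weight,
  \<open>m - 2 * n\<close>, by \<open>[F, E] = - H\<close>. Summing these contributions from 0 to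
  \<open>n\<close> gives the coefficient.\<close>

lemma lowering_string:
  "bracket F ((bracket E ^^ Suc n) V) = (real (Suc n) * (real m - real n)) *\<^sub>R (bracket E ^^ n) V"
proof (induction n)
  case 0
  show ?case
    using bracket_Jacobi[of F E V] bracket_antisym[of F E] by (simp add: EF FV HV bracket_simps bracket.zero_right)
next
  case (Suc n)
  have "bracket F ((bracket E ^^ Suc (Suc n)) V)
      = bracket (bracket F E) ((bracket E ^^ Suc n) V) + bracket E (bracket F ((bracket E ^^ Suc n) V))"
    by (simp add: bracket_Jacobi[of F E])
  also have "bracket F E = - H" using bracket_antisym[of F E] EF by simp
  also have "bracket (- H) ((bracket E ^^ Suc n) V) = - ((2 * real (Suc n) - real m) *\<^sub>R (bracket E ^^ Suc n) V)"
    by (simp only: bracket.minus_left weight_string)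
  also have "bracket E (bracket F ((bracket E ^^ Suc n) V))
      = bracket E ((real (Suc n) * (real m - real n)) *\<^sub>R (bracket E ^^ n) V)"
    by (simp only: Suc.IH)
  also have "\<dots> = (real (Suc n) * (real m - real n)) *\<^sub>R (bracket E ^^ Suc n) V"
    by (simp add: bracket.scaleR_right)
  finally show ?case
    by (simp only: scaleR_minus_left[symmetric] scaleR_left_distrib[symmetric]) (simp add: algebra_simps)
qed

text \<open>Going down from the top, step \<open>k + 1\<close> contributes the factor
  \<open>(m - k) * (k + 1)\<close> by \<open>lowering_string\<close>; the product telescopes to
  factorials.\<close>

lemma iterated_lowering:
  "k \<le> m \<Longrightarrow> (bracket F ^^ k) ((bracket E ^^ m) V) =
    (fact k * fact m / fact (m - k)) *\<^sub>R (bracket E ^^ (m - k)) V"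
proof (induction k)
  case (Suc k)
  then obtain d where d: "m - k = Suc d" "m - Suc k = d" "real m - real d = real (Suc k)"
    by (metis Suc_diff_Suc Suc_le_lessD diff_diff_cancel diff_Suc_Suc of_nat_diff le_diff_conv less_imp_le diff_le_self)
  have "(bracket F ^^ Suc k) ((bracket E ^^ m) V)
      = (fact k * fact m / fact (Suc d)) *\<^sub>R bracket F ((bracket E ^^ Suc d) V)"
    using Suc by (simp add: d(1) bracket.scaleR_right del: fact_Suc funpow.simps(2)) (simp add: bracket.scaleR_right)
  also have "\<dots> = (fact k * fact m / fact (Suc d) * (real (Suc d) * real (Suc k))) *\<^sub>R (bracket E ^^ d) V"
    by (simp only: lowering_string d(3) scaleR_scaleR)
  also have "fact k * fact m / fact (Suc d) * (real (Suc d) * real (Suc k)) = fact (Suc k) * fact m / fact d"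
    by (simp add: field_simps del: of_nat_Suc)
  finally show ?case by (simp only: d(2))
qed simp

text \<open>Since \<open>F\<close> lowers the string \<open>E\<^sup>n V\<close>, the series \<open>exp (t F) E\<^sup>m V\<close> runs through it backwards
  and equals \<open>t\<^sup>m m! exp (t E) V\<close>. Expanding \<open>exp (- t F) exp (t E) V\<close> directly would instead
  produce alternating binomial sums.\<close>

lemma Ad_Exp_string:
  assumes t: "t = 1 \<or> t = - 1"
  shows "Ad G K (Exp (- (t *\<^sub>R F))) (Ad G K (Exp (t *\<^sub>R E)) V) = (t ^ m / fact m) *\<^sub>R (bracket E ^^ m) V"
proof -
  have tt: "t * t = 1" using t by auto
  have "(bracket F ^^ m) ((bracket E ^^ m) V) = (fact m * fact m) *\<^sub>R V"
    using iterated_lowering[of m] by simp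
  then have nil: "(bracket F ^^ Suc m) ((bracket E ^^ m) V) = 0"
    by (simp add: bracket.scaleR_right FV)
  \<comment> \<open>As \<open>t * t = 1\<close>, the power \<open>t ^ k\<close> can be traded for
    \<open>t ^ m * t ^ (m - k)\<close>. Each coefficient then depends on \<open>k\<close> only
    through \<open>m - k\<close>, ready for reversing the sum.\<close>
  have coeff: "t ^ k / fact k * (fact k * fact m / fact (m - k)) = t ^ m * fact m * (t ^ (m - k) / fact (m - k))"
    if "k \<le> m" for k
  proof -
    have "t ^ m * t ^ (m - k) = t ^ k * (t * t) ^ (m - k)"
      using that by (simp add: power_mult_distrib mult.assoc flip: power_add)
    then have "t ^ m * t ^ (m - k) = t ^ k" by (simp add: tt)
    then show ?thesis by (simp add: field_simps)
  qed
  have "Ad G K (Exp (t *\<^sub>R F)) ((bracket E ^^ m) V)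
      = (\<Sum>k<Suc m. (t ^ k / fact k) *\<^sub>R (bracket F ^^ k) ((bracket E ^^ m) V))"
    by (rule Ad_Exp_nilpotent[OF nil])
  also have "\<dots> = (\<Sum>k<Suc m. (t ^ m * fact m) *\<^sub>R ((t ^ (m - k) / fact (m - k)) *\<^sub>R (bracket E ^^ (m - k)) V))"
    by (intro sum.cong HOL.refl) (simp add: iterated_lowering coeff del: times_divide_eq_left times_divide_eq_right)
  also have "\<dots> = (t ^ m * fact m) *\<^sub>R (\<Sum>k<Suc m. (t ^ k / fact k) *\<^sub>R (bracket E ^^ k) V)"
    unfolding scaleR_sum_right[symmetric]
    by (subst sum.nat_diff_reindex[symmetric]) simp
  also have "\<dots> = (t ^ m * fact m) *\<^sub>R Ad G K (Exp (t *\<^sub>R E)) V"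
    by (simp only: Ad_Exp_nilpotent[OF EV])
  finally have "(t ^ m / fact m) *\<^sub>R Ad G K (Exp (t *\<^sub>R F)) ((bracket E ^^ m) V)
      = (t * t) ^ m *\<^sub>R Ad G K (Exp (t *\<^sub>R E)) V"
    by (simp add: power_mult_distrib)
  then have "Ad G K (Exp (t *\<^sub>R E)) V = Ad G K (Exp (t *\<^sub>R F)) ((t ^ m / fact m) *\<^sub>R (bracket E ^^ m) V)"
    by (simp add: tt Ad_linear_simps)
  then show ?thesis by (simp only: Ad_Exp_minus)
qed

end

text \<open>On the span of \<open>E\<close>, \<open>H\<close> and \<open>F\<close> the series have
  at most three terms, so all factors are explicit and can be composed.\<close>

lemma Ad_sl2_triple:
  assumes EF: "bracket E F = H" and HE: "bracket H E = 2 *\<^sub>R E" and HF: "bracket H F = - (2 *\<^sub>R F)"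
  shows "Ad G K (Exp F) (Ad G K (Exp (- E)) (Ad G K (Exp F) E)) = - F"
    and "Ad G K (Exp F) (Ad G K (Exp (- E)) (Ad G K (Exp F) F)) = - E"
proof -
  have FE: "bracket F E = - H" and EH: "bracket E H = - (2 *\<^sub>R E)" and FH: "bracket F H = 2 *\<^sub>R F"
    using bracket_antisym[of F E] bracket_antisym[of E H] bracket_antisym[of F H] assms by simp_all
  note br = EF HE HF FE EH FH bracket_self bracket_simps bracket.zero_right bracket.zero_left
  have F: "Ad G K (Exp F) E = E - H - F" "Ad G K (Exp F) H = H + 2 *\<^sub>R F" "Ad G K (Exp F) F = F"
    using Ad_Exp_nilpotent_1[of 3 F E] Ad_Exp_nilpotent_1[of 2 F H] Ad_Exp_fixed[of F F]
    by (simp_all add: br eval_nat_numeral)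
  have E: "Ad G K (Exp (- E)) E = E" "Ad G K (Exp (- E)) H = H + 2 *\<^sub>R E"
      "Ad G K (Exp (- E)) F = F - H - E"
    using Ad_Exp_nilpotent_1[of 3 "- E" F] Ad_Exp_nilpotent_1[of 2 "- E" H] Ad_Exp_fixed[of "- E" E]
    by (simp_all add: br eval_nat_numeral)
  show "Ad G K (Exp F) (Ad G K (Exp (- E)) (Ad G K (Exp F) E)) = - F"
    and "Ad G K (Exp F) (Ad G K (Exp (- E)) (Ad G K (Exp F) F)) = - E"
    \<comment> \<open>With doubled vectors written as sums, the composition reduces to cancelling
      signed terms.\<close>
    by (simp_all add: E[unfolded scaleR_2] F[unfolded scaleR_2] Ad_linear_simps)
qed

end

section \<open>Chevalley--Serre generators\<close>

lemma chevalley_serre_generatorsD: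
  assumes "chevalley_serre_generators br I \<alpha> a h e f"
  shows "\<forall>j\<in>I. is_root br (vec.span (h ` I)) (\<alpha> j)"
    and "\<forall>i\<in>I. is_coroot br (vec.span (h ` I)) (\<alpha> i) (h i)"
    and "\<forall>i\<in>I. \<forall>j\<in>I. \<alpha> j (h i) = of_int (a i j)"
    and "\<forall>i\<in>I. \<forall>j\<in>I. br (h i) (e j) = of_int (a i j) *s e j"
    and "\<forall>i\<in>I. \<forall>j\<in>I. br (h i) (f j) = - (of_int (a i j) *s f j)"
    and "\<forall>i\<in>I. \<forall>j\<in>I. br (e i) (f j) = (if i = j then h j else 0)"
    and "\<forall>i\<in>I. \<forall>j\<in>I. i \<noteq> j \<longrightarrow> (br (e i) ^^ nat (1 - a i j)) (e j) = 0"
    and "\<forall>i\<in>I. \<forall>j\<in>I. i \<noteq> j \<longrightarrow> (br (f i) ^^ nat (1 - a i j)) (f j) = 0"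
  using assms unfolding chevalley_serre_generators_def simple_roots_def Let_def
  by - (elim conjE; assumption)+

text \<open>The sign is hidden in the Serre relation: for positive \<open>a i j\<close> the exponent
  \<open>nat (1 - a i j)\<close> is 0, and the relation would read \<open>e j = 0\<close>. But then
  \<open>h j = [e j, f j]\<close> would vanish, although it acts as 2 on the nonzero root space of
  \<open>\<alpha> j\<close>.\<close>

lemma chevalley_serre_generators_cartan_matrix:
  assumes gen: "chevalley_serre_generators br I \<alpha> a h e f"
    and left0: "\<And>y. br 0 y = 0" and i: "i \<in> I" and j: "j \<in> I"
  shows "a i i = 2" and "i \<noteq> j \<Longrightarrow> a i j \<le> 0"
proof -
  let ?H = "vec.span (h ` I)"
  note D = chevalley_serre_generatorsD[OF gen]
  have coroot: "\<alpha> i (h i) = 2" if "i \<in> I" for i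
    using D(2) that by (simp add: is_coroot_def)
  then have "complex_of_int (a i i) = 2"
    using D(3) i by simp
  then show "a i i = 2" by (metis of_int_eq_iff of_int_numeral)
  have "e j \<noteq> 0"
  proof
    assume "e j = 0"
    then have hj: "h j = 0"
      using bspec[OF bspec[OF D(6) j] j] left0 by simp
    obtain x where x: "x \<in> root_space br ?H (\<alpha> j)" "x \<noteq> 0"
      using bspec[OF D(1) j] by (auto simp: is_root_def)
    have "h j \<in> ?H" using j by (simp add: vec.span_base)
    then have "br (h j) x = 2 *s x"
      using x(1) coroot[OF j] by (simp add: root_space_def)
    then show False using x(2) left0 hj by (simp add: vec_eq_iff)
  qed
  moreover have "nat (1 - a i j) = 0" if "\<not> a i j \<le> 0" using that by simp
  ultimately show "a i j \<le> 0" if "i \<noteq> j"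
    using bspec[OF bspec[OF D(7) i] j] that by (cases "a i j \<le> 0") simp_all
qed

theorem proposition5p1:
  fixes G :: "'g :: {t2_space, second_countable_topology} monoid"
    and A :: "('g, 'n :: finite) chart set"
    and K :: "('g, 'n) chart"
    and Exp :: "complex ^ 'n \<Rightarrow> 'g"
    and I :: "'i set"
    and \<alpha> :: "'i \<Rightarrow> complex ^ 'n \<Rightarrow> complex"
    and a :: "'i \<Rightarrow> 'i \<Rightarrow> int"
    and h e f :: "'i \<Rightarrow> complex ^ 'n"
  assumes lie_group: "complex_lie_group G A"
    and connected: "connected (UNIV :: 'g set)"
    and simply_connected: "simply_connected (UNIV :: 'g set)"
    and chart: "K \<in> A" "\<one>\<^bsub>G\<^esub> \<in> dom_of K"
    and semisimple: "semisimple (lie_bracket G K)"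
    and exponential: "exponential_map G K Exp"
    and generators: "chevalley_serre_generators (lie_bracket G K) I \<alpha> a h e f"
  shows "(\<forall>\<phi> \<in> hom (tits_group I a) G.
            (\<forall>i\<in>I. \<phi> (tits_gen I a (Tau i)) = s_dot G Exp e f i) \<longrightarrow>
              group_action (tits_group I a) UNIV (\<lambda>w. Ad G K (\<phi> w)) \<and>
              (\<forall>i\<in>I. Ad G K (\<phi> (tits_gen I a (Tau i))) = Ad G K (s_dot G Exp e f i))) \<and>
         (\<forall>i\<in>I. Ad G K (s_dot G Exp e f i) (e i) = - f i \<and>
                 Ad G K (s_dot G Exp e f i) (f i) = - e i) \<and>
         (\<forall>i\<in>I. \<forall>j\<in>I. a i j = 0 \<longrightarrow>
                 Ad G K (s_dot G Exp e f i) (e j) = e j \<and>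
                 Ad G K (s_dot G Exp e f i) (f j) = f j) \<and>
         (\<forall>i\<in>I. \<forall>j\<in>I. i \<noteq> j \<longrightarrow>
                 Ad G K (s_dot G Exp e f i) (e j) =
                   ((- 1) ^ nat \<bar>a i j\<bar> / fact (nat \<bar>a i j\<bar>)) *s
                     (lie_bracket G K (e i) ^^ nat \<bar>a i j\<bar>) (e j) \<and>
                 Ad G K (s_dot G Exp e f i) (f j) =
                   (1 / fact (nat \<bar>a i j\<bar>)) *s
                     (lie_bracket G K (f i) ^^ nat \<bar>a i j\<bar>) (f j))"
proof -
  interpret complex_lie_exponential G A K Exp
    using lie_group chart exponential
    by (simp add: complex_lie_exponential_def complex_lie_chart_def complex_lie_exponential_axioms_def)
  let ?s = "s_dot G Exp e f"
  have s: "Ad G K (?s i) X = Ad G K (Exp (f i)) (Ad G K (Exp (- e i)) (Ad G K (Exp (f i)) X))" for i X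
    by (simp add: s_dot_def Ad_mult)
  note D = chevalley_serre_generatorsD[OF generators]
  \<comment> \<open>The relations have integer coefficients, so they can be rewritten with real
    scaling, for which linearity of \<open>Ad\<close> and of the bracket has been
    established.\<close>
  have int_scale: "complex_of_int k *s x = real_of_int k *\<^sub>R x" for k and x :: "complex ^ 'n"
    by (simp add: scaleR_eq_vector_scale)
  have he: "bracket (h i) (e j) = real_of_int (a i j) *\<^sub>R e j"
    and hf: "bracket (h i) (f j) = - (real_of_int (a i j) *\<^sub>R f j)"
    and ef: "bracket (e i) (f j) = (if i = j then h j else 0)"
    if "i \<in> I" "j \<in> I" for i j
    using D(4-6) that by (simp_all add: int_scale)
  have serre: "(bracket (e i) ^^ nat (1 - a i j)) (e j) = 0" "(bracket (f i) ^^ nat (1 - a i j)) (f j) = 0"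
    if "i \<in> I" "j \<in> I" "i \<noteq> j" for i j
    using D(7,8) that by simp_all
  note cartan = chevalley_serre_generators_cartan_matrix[OF generators bracket.zero_left]
  have same: "Ad G K (?s i) (e i) = - f i \<and> Ad G K (?s i) (f i) = - e i" if "i \<in> I" for i
    using Ad_sl2_triple[of "e i" "f i" "h i"] he[OF that that] hf[OF that that] ef[OF that that]
      cartan(1)[OF that that] by (simp add: s)
  have diff: "Ad G K (?s i) (e j) = ((- 1) ^ m / fact m) *s (bracket (e i) ^^ m) (e j) \<and>
      Ad G K (?s i) (f j) = (1 / fact m) *s (bracket (f i) ^^ m) (f j)"
    if ij: "i \<in> I" "j \<in> I" "i \<noteq> j" and m: "m = nat \<bar>a i j\<bar>" for i j m
  proof
    \<comment> \<open>As \<open>a i j \<le> 0\<close>, the Serre exponent is exactly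
      \<open>m + 1\<close>, the nilpotency required for a string of weight
      \<open>- m\<close>.\<close>
    have a: "real_of_int (a i j) = - real m" "nat (1 - a i j) = Suc m"
      using cartan(2)[OF ij] m by auto
    have fe: "bracket (f i) (e i) = - h i" "bracket (f i) (e j) = 0" "bracket (e i) (f j) = 0"
      using bracket_antisym[of "f i"] ef ij by simp_all
    have nil: "(bracket (e i) ^^ Suc m) (e j) = 0" "(bracket (f i) ^^ Suc m) (f j) = 0"
      using serre[OF ij] a(2) by simp_all
    have ii: "a i i = 2" by (rule cartan(1)[OF ij(1,1)])
    \<comment> \<open>The innermost \<open>Exp (f i)\<close> fixes \<open>e j\<close>, so only the
      outer two factors act; they form the case \<open>t = - 1\<close> of the string
      formula.\<close>
    have "Ad G K (Exp (- (- 1 *\<^sub>R f i))) (Ad G K (Exp (- 1 *\<^sub>R e i)) (e j))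
        = ((- 1) ^ m / fact m) *\<^sub>R (bracket (e i) ^^ m) (e j)"
      by (rule Ad_Exp_string[where H = "h i"]) (use ef he nil ij a ii fe in simp_all)
    then show "Ad G K (?s i) (e j) = ((- 1) ^ m / fact m) *s (bracket (e i) ^^ m) (e j)"
      by (simp add: s Ad_Exp_fixed fe scaleR_eq_vector_scale)
    let ?v = "(bracket (f i) ^^ m) (f j)"
    \<comment> \<open>Here \<open>f i\<close> raises and \<open>e i\<close> lowers, with
      \<open>t = 1\<close>. The inner two factors already yield the top vector \<open>?v\<close>,
      which the outer \<open>Exp (f i)\<close> fixes because \<open>f i\<close> kills it.\<close>
    have "Ad G K (Exp (- (1 *\<^sub>R e i))) (Ad G K (Exp (1 *\<^sub>R f i)) (f j)) = (1 ^ m / fact m) *\<^sub>R ?v"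
      by (rule Ad_Exp_string[where H = "- h i"])
        (use hf nil ij a ii fe in \<open>simp_all add: bracket.minus_left\<close>)
    moreover have "bracket (f i) ?v = 0" using nil(2) by simp
    ultimately have "Ad G K (?s i) (f j) = (1 / fact m) *\<^sub>R ?v"
      by (simp add: s Ad_linear_simps Ad_Exp_fixed)
    then show "Ad G K (?s i) (f j) = (1 / fact m) *s ?v"
      by (simp add: scaleR_eq_vector_scale)
  qed
  \<comment> \<open>Since \<open>a i i = 2\<close>, a zero entry forces \<open>i \<noteq> j\<close>,
    and the claim is the case \<open>m = 0\<close> of \<open>diff\<close>.\<close>
  have fixed: "Ad G K (?s i) (e j) = e j \<and> Ad G K (?s i) (f j) = f j"
    if "i \<in> I" "j \<in> I" "a i j = 0" for i j
    using diff[OF that(1,2) _ HOL.refl] cartan(1)[OF that(1,1)] that(3) by fastforce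
  have "group (tits_group I a)" unfolding tits_group_def by (rule group_presented_group)
  then show ?thesis
    using same fixed diff group_action_Ad by auto
qed

end
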